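(* Let $\mathbf{v}_0$ be a divergence-free vector field on $\Omega$ satisfying the no-slip condition $\mathbf{v}_0=0$ on $\partial\Omega$, the infinity condition $\mathbf{v}_0(\mathbf{x})\to\mathbf{v}_\infty$ as $|\mathbf{x}|\to\infty$, and the zero-circularity condition $\lim_{R\to\infty}\oint_{|\mathbf{x}|=R}\mathbf{v}_0\cdot d\mathbf{l}=0$, and such that $w_0(z)=(\operatorname{curl}\mathbf{v}_0)(\Phi^{-1}(z))$ belongs to $L_1(B_{r_0})$. Let $\mathbf{v}(t,\cdot)$, $t\ge0$, be a flow of velocity fields on $\Omega$ with $\mathbf{v}(0,\cdot)=\mathbf{v}_0$ as described in the context, and let $w(t,z)=(\operatorname{curl}\mathbf{v}(t,\cdot))(\Phi^{-1}(z))$, $z\in B_{r_0}$, be the corresponding vorticity flow. Then $w_0\in M$, and in order that the no-slip condition be conserved by the flow (that is, $\mathbf{v}(t,\cdot)=0$ on $\partial\Omega$ for all $t>0$) it is necessary that the affine subspace $M$ be invariant under the flow, i.e. that $w(t,\cdot)\in M$ for every $t>0$.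
   Context: Points $\mathbf{x}=(x_1,x_2)\in\mathbb{R}^2$ are identified with $z=x_1+ix_2\in\mathbb{C}$; for $\mathbf{v}=(v_1,v_2)$, $\operatorname{curl}\mathbf{v}=\partial_{x_1}v_2-\partial_{x_2}v_1$. Let $r_0>0$ and $B_{r_0}=\{\mathbf{x}\in\mathbb{R}^2:|\mathbf{x}|>r_0\}$. Let $\Omega=\mathbb{R}^2\setminus B$, where $B$ is a bounded simply connected domain with piecewise smooth boundary, and let $\Phi$ be a Riemann (conformal) mapping of $\Omega$ onto $B_{r_0}$ such that $\Phi(z)=z+O(1/z)$ and $\Phi'(z)=1+O(1/z^2)$ as $z\to\infty$. The constant $\mathbf{v}_\infty=(v_{\infty,x},v_{\infty,y})\in\mathbb{R}^2$ is given, and $v_{\infty,r,k}=\frac{\delta_{|k|,1}}{2}(v_{\infty,x}-ik\,v_{\infty,y})$ for $k\in\mathbb{Z}$. The affine subspace $M$ is $$M=\Big\{f\in L_1(B_{r_0})\ \Big|\ \int_{B_{r_0}}\overline{(\Phi^{-1})'(z)}\,\frac{f(\mathbf{x})}{z^k}\,d\mathbf{x}=4\pi ik\,v_{\infty,r,k},\ k\ge0,\ k\in\mathbb{Z}\Big\}.$$ Standing assumptions on the flow: for each $t\ge0$ the field $\mathbf{v}(t,\cdot)$ is divergence-free on $\Omega$, $w(t,\cdot)\in L_1(B_{r_0})$, $\mathbf{v}(t,\mathbf{x})\to\mathbf{v}_\infty$ as $|\mathbf{x}|\to\infty$, and $\lim_{R\to\infty}\oint_{|\mathbf{x}|=R}\mathbf{v}(t,\cdot)\cdot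 d\mathbf{l}=0$. *)

theory Defs
  imports "HOL-Complex_Analysis.Complex_Analysis" "HOL-Library.Landau_Symbols"
begin

text \<open>
  Points and vectors of the plane are complex numbers: \<open>x = (x1, x2)\<close> is \<open>x1 + \<i> x2\<close>, and a
  vector field \<open>v = (v1, v2)\<close> is \<open>v :: complex \<Rightarrow> complex\<close> with \<open>v1 = Re v\<close>, \<open>v2 = Im v\<close>.
\<close>

definition partial1 :: "(complex \<Rightarrow> complex) \<Rightarrow> complex \<Rightarrow> complex" where
  "partial1 v z = vector_derivative (\<lambda>s::real. v (Complex s (Im z))) (at (Re z))"

definition partial2 :: "(complex \<Rightarrow> complex) \<Rightarrow> complex \<Rightarrow> complex" where
  "partial2 v z = vector_derivative (\<lambda>s::real. v (Complex (Re z) s)) (at (Im z))"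

definition curl :: "(complex \<Rightarrow> complex) \<Rightarrow> complex \<Rightarrow> real" where
  "curl v z = Im (partial1 v z) - Re (partial2 v z)"

definition divergence :: "(complex \<Rightarrow> complex) \<Rightarrow> complex \<Rightarrow> real" where
  "divergence v z = Re (partial1 v z) + Im (partial2 v z)"

text \<open>The line integral of \<open>v\<close> over the circle \<open>|x| = R\<close>, counterclockwise; \<open>\<bullet>\<close> is the
  Euclidean inner product of the plane.\<close>

definition circulation :: "(complex \<Rightarrow> complex) \<Rightarrow> real \<Rightarrow> real" where
  "circulation v R =
     integral {0..2 * pi} (\<lambda>\<theta>. v (of_real R * cis \<theta>) \<bullet> (of_real R * \<i> * cis \<theta>))"

definition outer_disc :: "real \<Rightarrow> complex set" where
  "outer_disc r0 = {z. r0 < norm z}"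

text \<open>\<open>valid_path\<close> is piecewise \<open>C\<^sup>1\<close>. The loop is not required to be simple or regular, so
  corners, cusps and slits are all allowed.\<close>

definition piecewise_smooth_boundary :: "complex set \<Rightarrow> bool" where
  "piecewise_smooth_boundary B \<longleftrightarrow>
     (\<exists>\<gamma>. valid_path \<gamma> \<and> pathfinish \<gamma> = pathstart \<gamma> \<and> path_image \<gamma> = frontier B)"

text \<open>
  The closed set \<open>\<Omega>\<close> contains its boundary, on which the no-slip condition is imposed, whereas
  \<open>|z| > r0\<close> is open; so the conformal map is defined on the interior of \<open>\<Omega>\<close>.
\<close>

definition exterior_riemann_map :: "real \<Rightarrow> complex set \<Rightarrow> (complex \<Rightarrow> complex) \<Rightarrow> bool" where
  "exterior_riemann_map r0 \<Omega> \<Phi> \<longleftrightarrow>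
     \<Phi> holomorphic_on interior \<Omega> \<and>
     bij_betw \<Phi> (interior \<Omega>) (outer_disc r0) \<and>
     (\<lambda>z. \<Phi> z - z) \<in> O[at_infinity](\<lambda>z. 1 / z) \<and>
     (\<lambda>z. deriv \<Phi> z - 1) \<in> O[at_infinity](\<lambda>z. 1 / z ^ 2)"

abbreviation riemann_inv :: "complex set \<Rightarrow> (complex \<Rightarrow> complex) \<Rightarrow> complex \<Rightarrow> complex" where
  "riemann_inv \<Omega> \<Phi> \<equiv> inv_into (interior \<Omega>) \<Phi>"

text \<open>
  Regularity making \<open>curl\<close>, the divergence and the boundary values classical: continuous on the
  closed set \<open>\<Omega>\<close>, \<open>C\<^sup>1\<close> inside, with first derivatives Lebesgue integrable on the bounded parts
  of \<open>\<Omega>\<close>. The last clause holds for every field that is \<open>C\<^sup>1\<close> up to the boundary. At a corner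
  of the boundary \<open>(\<Phi>\<inverse>)'\<close> may be unbounded, and integrability of the vorticity on \<open>|z| > r0\<close>
  alone would not make the integrals in \<open>moment_space\<close> below exist.
\<close>

definition velocity_field_on :: "complex set \<Rightarrow> (complex \<Rightarrow> complex) \<Rightarrow> bool" where
  "velocity_field_on \<Omega> v \<longleftrightarrow>
     continuous_on \<Omega> v \<and>
     v differentiable_on interior \<Omega> \<and>
     continuous_on (interior \<Omega>) (partial1 v) \<and>
     continuous_on (interior \<Omega>) (partial2 v) \<and>
     (\<forall>R. partial1 v absolutely_integrable_on (interior \<Omega> \<inter> ball 0 R) \<and>
          partial2 v absolutely_integrable_on (interior \<Omega> \<inter> ball 0 R))"

definition divergence_free_on :: "complex set \<Rightarrow> (complex \<Rightarrow> complex) \<Rightarrow> bool" where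
  "divergence_free_on \<Omega> v \<longleftrightarrow> (\<forall>z\<in>interior \<Omega>. divergence v z = 0)"

definition no_slip :: "complex set \<Rightarrow> (complex \<Rightarrow> complex) \<Rightarrow> bool" where
  "no_slip \<Omega> v \<longleftrightarrow> (\<forall>z\<in>frontier \<Omega>. v z = 0)"

definition vorticity ::
  "complex set \<Rightarrow> (complex \<Rightarrow> complex) \<Rightarrow> (complex \<Rightarrow> complex) \<Rightarrow> complex \<Rightarrow> real" where
  "vorticity \<Omega> \<Phi> v z = curl v (riemann_inv \<Omega> \<Phi> z)"

definition vinf_r :: "complex \<Rightarrow> int \<Rightarrow> complex" where
  "vinf_r vinf k =
     (if \<bar>k\<bar> = 1 then 1 else 0) / 2 * (of_real (Re vinf) - \<i> * of_int k * of_real (Im vinf))"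

text \<open>
  The affine subspace \<open>M\<close>, of functions rather than classes modulo null sets. Existence of each
  integral is required explicitly, as the Bochner integral of a non-integrable function is \<open>0\<close>.
\<close>

definition moment_space ::
  "real \<Rightarrow> complex set \<Rightarrow> (complex \<Rightarrow> complex) \<Rightarrow> complex \<Rightarrow> (complex \<Rightarrow> real) set" where
  "moment_space r0 \<Omega> \<Phi> vinf =
     {f. f absolutely_integrable_on outer_disc r0 \<and>
         (\<forall>k::nat.
            (\<lambda>z. cnj (deriv (riemann_inv \<Omega> \<Phi>) z) * (of_real (f z) / z ^ k))
               absolutely_integrable_on outer_disc r0 \<and>
            (LINT z : outer_disc r0 | lebesgue.
               cnj (deriv (riemann_inv \<Omega> \<Phi>) z) * (of_real (f z) / z ^ k))
              = 4 * of_real pi * \<i> * of_nat k * vinf_r vinf (int k))}"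

end

theory Submission
  imports Defs
begin

text \<open>
  All the work is about a single velocity field \<open>V\<close> without slip; the statement on the flow applies
  it at each time separately.

  Write \<open>G = \<Phi>\<inverse>\<close>, and for a real-linear map \<open>L\<close> of the plane let \<open>dbar L = \<i> L(1) - L(\<i>)\<close>, so
  that \<open>dbar\<close> of a differential is \<open>2\<i>\<close> times the Wirtinger derivative in the conjugate variable.
  A field \<open>V\<close> has \<open>dbar (cnj V) = curl V + \<i> div V\<close>, and composition with, or multiplication by, a
  holomorphic function only produces a factor. Hence for a divergence-free field the integrand
  \<open>cnj (G' \<zeta>) w(\<zeta>) / \<zeta>^k\<close> of the \<open>k\<close>-th moment is exactly \<open>dbar\<close> of \<open>cnj (V (G \<zeta>)) / \<zeta>^k\<close>, and
  Green's formula turns its integral over \<open>r0 < |\<zeta>| < r\<close> into a difference of two circle integrals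
  of \<open>cnj (V (G \<zeta>)) / \<zeta>^k\<close>. Applying Green in the \<open>\<zeta>\<close>-plane keeps the contours circles, whatever
  the shape of \<open>\<partial>\<Omega>\<close>. The conformal map is proper, so the no-slip condition makes \<open>V \<circ> G\<close>
  tend to \<open>0\<close> uniformly as \<open>|\<zeta>|\<close> decreases to \<open>r0\<close>, and the inner circle contributes nothing
  (\<open>moment_annulus\<close>). On the outer circle \<open>V \<circ> G\<close> tends to \<open>vinf\<close>, which gives \<open>2\<pi>\<i> cnj vinf\<close> for
  \<open>k = 1\<close> and \<open>0\<close> for \<open>k \<ge> 2\<close> (\<open>first_moment\<close>, \<open>higher_moments\<close>).

  The moment \<open>k = 0\<close> is the delicate one (\<open>zeroth_moment\<close>): the length of the circle is not
  compensated by any decay, and the hypothesis on the circulation concerns circles in the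
  \<open>z\<close>-plane, whose images under \<open>\<Phi>\<close> are not circles. As \<open>G' = 1 + O(\<zeta>\<^sup>-\<^sup>2)\<close>, the circle integral of
  \<open>cnj (V \<circ> G)\<close> has the same limit as that of \<open>cnj (V \<circ> G) G'\<close>, that is, as the integral of
  \<open>cnj V dz\<close> over the \<open>G\<close>-image of the circle. This contour and a large circle of the \<open>z\<close>-plane are
  compared not with each other but each with an area integral: both integrals equal
  the integral of \<open>curl V\<close> over the enclosed part of \<open>{z. V z \<noteq> 0}\<close>
  (\<open>circle_integral_conformal\<close>, \<open>circle_integral_physical\<close>). So they have a common limit, the
  integral of \<open>curl V\<close> over the whole of \<open>{z. V z \<noteq> 0}\<close>. It is real, and the real parts of the integrals over
  large circles are the circulations, which tend to \<open>0\<close>.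

  In the proofs of these two area formulas \<open>V\<close> is first replaced by a smooth truncation that vanishes wherever \<open>|V|\<^sup>2 \<le> 1/n\<close>, hence near the boundary. As the derivatives of
  the truncations are bounded uniformly in \<open>n\<close>, integrability of the gradient of \<open>V\<close> on bounded
  sets allows dominated convergence as \<open>n\<close> tends to infinity.
\<close>

section \<open>Conformal change of variables in the complex plane\<close>

text \<open>
  On boxes this is the substitution rule for a map that preserves boxes and their contents. An
  isometry also preserves the balls in the definition of the integral over an unbounded set, so the
  rule extends to arbitrary sets.
\<close>

lemma has_integral_isometric_image:
  fixes T :: "'a::euclidean_space \<Rightarrow> 'b::euclidean_space" and f :: "'b \<Rightarrow> 'c::banach"
  assumes TT: "\<And>x. T' (T x) = x" "\<And>y. T (T' y) = y"
    and nrm: "\<And>x. norm (T x) = norm x" and cont: "\<And>x. continuous (at x) T"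
    and box: "\<And>u v. T ` cbox u v = cbox (T u) (T v)"
    and con: "\<And>u v. measure lborel (cbox (T u) (T v)) = measure lborel (cbox u v)"
    and f: "(f has_integral i) (T ` S)"
  shows "((\<lambda>x. f (T x)) has_integral i) S"
proof -
  define F where "F = (\<lambda>y. if y \<in> T ` S then f y else 0)"
  have FT: "F (T x) = (if x \<in> S then f (T x) else 0)" for x
    unfolding F_def by (smt (verit) TT(1) image_iff)
  have box': "T' ` cbox (T u) (T v) = cbox u v" for u v
    by (metis (no_types, lifting) TT(1) box image_image image_cong image_ident)
  have tw: "((\<lambda>x. F (T x)) has_integral z) (cbox a b)"
    if "(F has_integral z) (cbox (T a) (T b))" for a b :: 'a and z
  proof -
    have "((\<lambda>x. F (T x)) has_integral (1 / 1) *\<^sub>R z) (T' ` cbox (T a) (T b))"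
    proof (rule has_integral_twiddle[OF _ _ _ cont _ _ _ that])
      show "\<exists>w z. T' ` cbox u v = cbox w z" for u v
        by (metis TT(2) box')
    qed (use TT box con in auto)
    then show ?thesis by (simp add: box')
  qed
  have 1: "F integrable_on cbox a b" for a b
    using f unfolding has_integral_alt' F_def by auto
  have 2: "\<exists>B>0. \<forall>a b. ball (0::'b) B \<subseteq> cbox a b \<longrightarrow> norm (integral (cbox a b) F - i) < e" if "e > 0" for e
    using f that unfolding has_integral_alt' F_def by auto
  have eq: "integral (cbox a b) (\<lambda>x. F (T x)) = integral (cbox (T a) (T b)) F" for a b :: 'a
    using tw 1 by (metis integrable_integral integral_unique)
  show ?thesis
    unfolding has_integral_alt' FT[symmetric]
  proof (intro conjI allI impI)
    show "(\<lambda>x. F (T x)) integrable_on cbox a b" for a b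
      using tw 1 by (meson has_integral_integrable_integral)
    fix e :: real assume "e > 0"
    then obtain B where B: "B > 0" "\<And>a b. ball 0 B \<subseteq> cbox a b \<Longrightarrow> norm (integral (cbox a b) F - i) < e"
      using 2 by metis
    show "\<exists>B>0. \<forall>a b. ball 0 B \<subseteq> cbox a b \<longrightarrow> norm (integral (cbox a b) (\<lambda>x. F (T x)) - i) < e"
    proof (intro exI conjI allI impI)
      fix a b :: 'a assume s: "ball 0 B \<subseteq> cbox a b"
      have "ball 0 B \<subseteq> T ` cbox a b"
      proof
        fix y assume "y \<in> ball (0::'b) B"
        then have "T' y \<in> ball 0 B" using nrm[of "T' y"] TT by simp
        then show "y \<in> T ` cbox a b" using s TT by (metis image_eqI subsetD)
      qed
      then show "norm (integral (cbox a b) (\<lambda>x. F (T x)) - i) < e"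
        unfolding eq using B(2) box by metis
    qed (rule B(1))
  qed
qed

definition vec2_to_complex :: "real^2 \<Rightarrow> complex" where
  "vec2_to_complex x = Complex (x $ 1) (x $ 2)"

definition complex_to_vec2 :: "complex \<Rightarrow> real^2" where
  "complex_to_vec2 z = vector [Re z, Im z]"

lemma vec2_complex_inverse [simp]:
  "complex_to_vec2 (vec2_to_complex x) = x" "vec2_to_complex (complex_to_vec2 z) = z"
  by (simp_all add: vec2_to_complex_def complex_to_vec2_def vec_eq_iff forall_2)

lemma norm_vec2_complex [simp]:
  "norm (vec2_to_complex x) = norm x" "norm (complex_to_vec2 z) = norm z"
  by (simp_all add: vec2_to_complex_def complex_to_vec2_def norm_vec_def L2_set_def cmod_def sum_2)

lemma linear_vec2_complex: "bounded_linear vec2_to_complex" "bounded_linear complex_to_vec2"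
proof -
  show "bounded_linear vec2_to_complex"
    by (rule bounded_linear_intro[where K=1])
       (auto simp del: vec2_complex_inverse simp: vec2_to_complex_def[abs_def] complex_eq_iff norm_vec_def L2_set_def cmod_def sum_2)
  show "bounded_linear complex_to_vec2"
    by (rule bounded_linear_intro[where K=1])
       (simp_all add: complex_to_vec2_def vec_eq_iff forall_2 norm_vec_def L2_set_def cmod_def sum_2)
qed

lemma mem_cbox_complex: "z \<in> cbox a b \<longleftrightarrow> Re a \<le> Re z \<and> Re z \<le> Re b \<and> Im a \<le> Im z \<and> Im z \<le> Im b"
  for a b z :: complex
  by (auto simp: mem_box Basis_complex_def)

lemma content_cbox_complex:
  "measure lborel (cbox a b) = (if Re a \<le> Re b \<and> Im a \<le> Im b then (Re b - Re a) * (Im b - Im a) else 0)"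
  for a b :: complex
  by (auto simp: content_cbox_if Basis_complex_def box_eq_empty not_le)

lemma cbox_vec2_complex:
  "vec2_to_complex ` cbox u v = cbox (vec2_to_complex u) (vec2_to_complex v)"
  "complex_to_vec2 ` cbox a b = cbox (complex_to_vec2 a) (complex_to_vec2 b)"
proof -
  have 1: "vec2_to_complex x \<in> cbox (vec2_to_complex u) (vec2_to_complex v) \<longleftrightarrow> x \<in> cbox u v" for x u v
    by (auto simp: mem_cbox_complex mem_box_cart vec2_to_complex_def forall_2)
  show "vec2_to_complex ` cbox u v = cbox (vec2_to_complex u) (vec2_to_complex v)" for u v
    using 1 by (auto simp: image_iff) (metis vec2_complex_inverse(2))
  then show "complex_to_vec2 ` cbox a b = cbox (complex_to_vec2 a) (complex_to_vec2 b)"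
    by (metis (no_types, lifting) vec2_complex_inverse image_image image_cong image_ident)
qed

lemma content_vec2_complex:
  "measure lborel (cbox (vec2_to_complex u) (vec2_to_complex v)) = measure lborel (cbox u v)"
  "measure lborel (cbox (complex_to_vec2 a) (complex_to_vec2 b)) = measure lborel (cbox a b)"
proof -
  show "measure lborel (cbox (vec2_to_complex u) (vec2_to_complex v)) = measure lborel (cbox u v)" for u v
  proof -
    have "cbox u v = {} \<longleftrightarrow> \<not> (u $ 1 \<le> v $ 1 \<and> u $ 2 \<le> v $ 2)"
      using interval_ne_empty_cart(1)[of u v] by (auto simp: forall_2)
    then show ?thesis
      by (auto simp: content_cbox_complex content_cbox_if_cart vec2_to_complex_def UNIV_2)
  qed
  from this[of "complex_to_vec2 a" "complex_to_vec2 b"]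
  show "measure lborel (cbox (complex_to_vec2 a) (complex_to_vec2 b)) = measure lborel (cbox a b)" by simp
qed

lemma has_integral_vec2_complex:
  fixes f :: "complex \<Rightarrow> 'c::banach"
  shows "((\<lambda>x. f (vec2_to_complex x)) has_integral i) (complex_to_vec2 ` S) \<longleftrightarrow> (f has_integral i) S"
proof
  have c: "continuous (at x) vec2_to_complex" "continuous (at y) complex_to_vec2" for x y
    using linear_vec2_complex linear_continuous_at by blast+
  show "(f has_integral i) S" if "((\<lambda>x. f (vec2_to_complex x)) has_integral i) (complex_to_vec2 ` S)"
    using has_integral_isometric_image[of vec2_to_complex complex_to_vec2, OF _ _ _ c(2) _ _ that]
    by (simp add: cbox_vec2_complex content_vec2_complex)
  show "((\<lambda>x. f (vec2_to_complex x)) has_integral i) (complex_to_vec2 ` S)" if "(f has_integral i) S"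
    by (rule has_integral_isometric_image[of complex_to_vec2 vec2_to_complex, OF _ _ _ c(1)])
       (simp_all add: cbox_vec2_complex content_vec2_complex image_image that)
qed

lemma absolutely_integrable_vec2_complex:
  fixes f :: "complex \<Rightarrow> 'c::euclidean_space"
  shows "(\<lambda>x. f (vec2_to_complex x)) absolutely_integrable_on (complex_to_vec2 ` S) \<longleftrightarrow> f absolutely_integrable_on S"
  unfolding absolutely_integrable_on_def integrable_on_def has_integral_vec2_complex
  using has_integral_vec2_complex[of "\<lambda>z. norm (f z)"] by simp

lemma lebesgue_vec2_complex:
  assumes "S \<in> sets lebesgue" shows "complex_to_vec2 ` S \<in> sets lebesgue"
  by (rule differentiable_image_in_sets_lebesgue[OF assms])
     (auto intro!: linear_imp_differentiable_on simp: bounded_linear.linear linear_vec2_complex)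

text \<open>
  Transport of the change of variables theorem along the isometry with \<open>real^2\<close>. The Jacobian of a holomorphic map is \<open>|f'|\<^sup>2\<close> by the Cauchy-Riemann equations.
\<close>

lemma conformal_change_of_variables:
  fixes f f' :: "complex \<Rightarrow> complex" and g :: "complex \<Rightarrow> complex"
  assumes S: "S \<in> sets lebesgue"
    and der: "\<And>z. z \<in> S \<Longrightarrow> (f has_field_derivative f' z) (at z within S)"
    and inj: "inj_on f S"
  shows "(\<lambda>z. of_real ((norm (f' z))\<^sup>2) * g (f z)) absolutely_integrable_on S \<and>
           integral S (\<lambda>z. of_real ((norm (f' z))\<^sup>2) * g (f z)) = b
     \<longleftrightarrow> g absolutely_integrable_on (f ` S) \<and> integral (f ` S) g = b"
proof -
  let ?T = vec2_to_complex and ?T' = complex_to_vec2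
  define F where "F = (\<lambda>x. ?T' (f (?T x)))"
  define F' where "F' = (\<lambda>x h. ?T' (f' (?T x) * ?T h))"
  define k where "k = (\<lambda>x. ?T' (g (?T x)))"
  have det: "\<bar>det (matrix (F' x))\<bar> = (norm (f' (?T x)))\<^sup>2" for x
  proof -
    have "det (matrix (F' x)) = (Re (f' (?T x)))\<^sup>2 + (Im (f' (?T x)))\<^sup>2"
      by (simp add: det_2 matrix_def F'_def axis_def complex_to_vec2_def vec2_to_complex_def power2_eq_square)
    then show ?thesis by (simp add: cmod_power2)
  qed
  have 1: "(\<lambda>x. \<bar>det (matrix (F' x))\<bar> *\<^sub>R k (F x)) absolutely_integrable_on (?T' ` S) \<and>
           integral (?T' ` S) (\<lambda>x. \<bar>det (matrix (F' x))\<bar> *\<^sub>R k (F x)) = ?T' b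
     \<longleftrightarrow> k absolutely_integrable_on (F ` ?T' ` S) \<and> integral (F ` ?T' ` S) k = ?T' b"
  proof (rule has_absolute_integral_change_of_variables)
    show "?T' ` S \<in> sets lebesgue" by (rule lebesgue_vec2_complex[OF S])
    show "inj_on F (?T' ` S)"
      using inj by (auto simp: inj_on_def F_def) (metis vec2_complex_inverse(2))
    fix x assume "x \<in> ?T' ` S"
    then have x: "?T x \<in> S" by auto
    have d1: "(?T has_derivative ?T) (at x within ?T' ` S)"
      by (intro bounded_linear_imp_has_derivative linear_vec2_complex)
    have "(f has_derivative (*) (f' (?T x))) (at (?T x) within ?T ` ?T' ` S)"
      using der[OF x] by (simp add: has_field_derivative_def image_image)
    from has_derivative_in_compose[OF d1 this]
    have "((\<lambda>x. f (?T x)) has_derivative (\<lambda>h. f' (?T x) * ?T h)) (at x within ?T' ` S)" by simp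
    then show "(F has_derivative F' x) (at x within ?T' ` S)"
      unfolding F_def F'_def by (rule bounded_linear.has_derivative[OF linear_vec2_complex(2)])
  qed
  have kF: "\<bar>det (matrix (F' x))\<bar> *\<^sub>R k (F x) = ?T' (of_real ((norm (f' (?T x)))\<^sup>2) * g (f (?T x)))" for x
    unfolding det k_def F_def
    by (simp only: vec2_complex_inverse scaleR_conv_of_real[symmetric] linear_scale[OF bounded_linear.linear[OF linear_vec2_complex(2)]])
  have Timg: "F ` ?T' ` S = ?T' ` f ` S" by (simp add: F_def image_image)
  have out: "(\<lambda>x. ?T' (p (?T x))) absolutely_integrable_on (?T' ` A) \<and> integral (?T' ` A) (\<lambda>x. ?T' (p (?T x))) = ?T' b
     \<longleftrightarrow> p absolutely_integrable_on A \<and> integral A p = b" for p :: "complex \<Rightarrow> complex" and A b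
  proof -
    have a: "(\<lambda>x. ?T' (p (?T x))) absolutely_integrable_on (?T' ` A) \<longleftrightarrow> p absolutely_integrable_on A"
      using absolutely_integrable_vec2_complex[where f = "\<lambda>z. ?T' (p z)"]
        absolutely_integrable_linear[OF _ linear_vec2_complex(1), where f = "\<lambda>z. ?T' (p z)"]
        absolutely_integrable_linear[OF _ linear_vec2_complex(2), where f = p]
      by (auto simp: o_def)
    have "integral (?T' ` A) (\<lambda>x. ?T' (p (?T x))) = ?T' (integral A p)" if "p integrable_on A"
    proof -
      have "((\<lambda>z. ?T' (p z)) has_integral ?T' (integral A p)) A"
        using has_integral_linear[OF integrable_integral[OF that] linear_vec2_complex(2)] by (simp add: o_def)
      then show ?thesis by (metis has_integral_vec2_complex[of "\<lambda>z. ?T' (p z)"] integral_unique)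
    qed
    moreover have "p integrable_on A" if "p absolutely_integrable_on A"
      using that by (simp add: absolutely_integrable_on_def)
    ultimately show ?thesis using a by (metis vec2_complex_inverse(2))
  qed
  show ?thesis
    using 1 unfolding kF Timg unfolding k_def
    using out[where p = "\<lambda>z. of_real ((norm (f' z))\<^sup>2) * g (f z)" and A = S and b = b] out[where p = g and A = "f ` S" and b = b] by simp
qed

lemma integral_rectangle:
  fixes f :: "complex \<Rightarrow> complex"
  assumes "continuous_on (cbox (Complex a c) (Complex b d)) f"
  shows "integral (cbox (Complex a c) (Complex b d)) f = integral {a..b} (\<lambda>x. integral {c..d} (\<lambda>y. f (Complex x y)))"
    and "integral (cbox (Complex a c) (Complex b d)) f = integral {c..d} (\<lambda>y. integral {a..b} (\<lambda>x. f (Complex x y)))"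
proof -
  let ?T = "\<lambda>p::real\<times>real. Complex (fst p) (snd p)" and ?R = "cbox (Complex a c) (Complex b d)"
  have bl: "bounded_linear ?T"
    by (rule bounded_linear_intro[where K=1])
       (auto simp: complex_eq_iff norm_prod_def cmod_def)
  have img: "?T ` cbox u v = cbox (?T u) (?T v)" for u v
  proof -
    have "z \<in> ?T ` cbox u v" if "z \<in> cbox (?T u) (?T v)" for z
      using that by (intro image_eqI[of _ _ "(Re z, Im z)"]) (auto simp: mem_cbox_complex cbox_Pair_eq mem_Times_iff cbox_Pair_iff[of _ _ "fst u" "snd u" "fst v" "snd v", simplified])
    then show ?thesis by (auto simp: mem_cbox_complex cbox_Pair_iff[of _ _ "fst u" "snd u" "fst v" "snd v", simplified])
  qed
  have con: "measure lborel (cbox (?T u) (?T v)) = measure lborel (cbox u v)" for u v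
    using content_Pair[of "fst u" "snd u" "fst v" "snd v"]
    by (auto simp: content_cbox_complex content_real_if)
  have "((\<lambda>p. f (?T p)) has_integral (integral ?R f)) (cbox (a,c) (b,d))"
  proof (rule has_integral_isometric_image[where T = ?T and T' = "\<lambda>z. (Re z, Im z)"])
    show "continuous (at x) ?T" for x
      using bl linear_continuous_at by blast
    show "(f has_integral integral ?R f) (?T ` cbox (a, c) (b, d))"
      using img[of "(a,c)" "(b,d)"] integrable_continuous[OF assms] by (simp add: integrable_integral)
  qed (use img con in \<open>auto simp: norm_prod_def cmod_def\<close>)
  then have eq: "integral ?R f = integral (cbox (a,c) (b,d)) (\<lambda>(x,y). f (Complex x y))"
    unfolding case_prod_beta by (rule integral_unique[symmetric])
  have cont: "continuous_on (cbox (a,c) (b,d)) (\<lambda>(x,y). f (Complex x y))"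
    unfolding case_prod_beta
    using continuous_on_compose2[OF assms, of "cbox (a,c) (b,d)" ?T] img[of "(a,c)" "(b,d)"]
      linear_continuous_on[OF bl] by auto
  show "integral ?R f = integral {a..b} (\<lambda>x. integral {c..d} (\<lambda>y. f (Complex x y)))"
    unfolding eq integral_prod_continuous[OF cont] by simp
  then show "integral ?R f = integral {c..d} (\<lambda>y. integral {a..b} (\<lambda>x. f (Complex x y)))"
    using integral_swap_continuous[OF cont] by simp
qed

section \<open>Green's formula on an annulus\<close>

text \<open>
  Real continuous differentiability, with the differential \<open>D\<close> carried along explicitly, since
  Green's formula is about its values.
\<close>

definition real_C1_on :: "complex set \<Rightarrow> (complex \<Rightarrow> complex) \<Rightarrow> (complex \<Rightarrow> complex \<Rightarrow> complex) \<Rightarrow> bool" where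
  "real_C1_on S Y D \<longleftrightarrow> open S \<and> (\<forall>z\<in>S. (Y has_derivative D z) (at z)) \<and> (\<forall>h. continuous_on S (\<lambda>z. D z h))"

text \<open>
  If \<open>L\<close> is the differential of \<open>f\<close>, this is \<open>2\<i> \<partial>f/\<partial>z\<close> with \<open>z\<close> conjugated; the factor \<open>2\<i>\<close> makes
  \<open>dbar\<close> of the differential of \<open>cnj V\<close> equal to \<open>curl V + \<i> div V\<close>.
\<close>

definition dbar :: "(complex \<Rightarrow> complex) \<Rightarrow> complex" where
  "dbar L = \<i> * L 1 - L \<i>"

text \<open>
  The complex contour integral over the counterclockwise circle, with \<open>dz = \<i> r exp (\<i> \<theta>) d\<theta>\<close>.
\<close>

definition circle_integral :: "(complex \<Rightarrow> complex) \<Rightarrow> real \<Rightarrow> complex" where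
  "circle_integral Y r = integral {0..2 * pi} (\<lambda>\<theta>. Y (of_real r * cis \<theta>) * (\<i> * of_real r * cis \<theta>))"

definition annulus :: "real \<Rightarrow> real \<Rightarrow> complex set" where
  "annulus a b = {z. a < norm z \<and> norm z < b}"

lemma open_annulus: "open (annulus a b)"
  unfolding annulus_def by (intro open_Collect_conj open_Collect_less continuous_intros)

lemma real_linear_complex:
  assumes "linear L" shows "L h = of_real (Re h) * L 1 + of_real (Im h) * L \<i>"
proof -
  have "L h = L (Re h *\<^sub>R 1 + Im h *\<^sub>R \<i>)"
    by (rule arg_cong[of _ _ L]) (simp add: complex_eq_iff)
  also have "\<dots> = Re h *\<^sub>R L 1 + Im h *\<^sub>R L \<i>" by (simp only: linear_add[OF assms] linear_scale[OF assms])
  finally show ?thesis by (simp add: scaleR_conv_of_real)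
qed

text \<open>
  These two rules are why \<open>dbar\<close> is the right derivative here: holomorphic factors pass through it,
  and a holomorphic substitution multiplies it by the conjugate of the derivative.
\<close>

lemma dbar_compose_holomorphic:
  assumes "linear L" shows "dbar (\<lambda>h. L (c * h)) = cnj c * dbar L"
  unfolding dbar_def
  by (subst (1 2) real_linear_complex[OF assms]) (simp add: complex_eq_iff algebra_simps)

lemma dbar_times_holomorphic: "dbar (\<lambda>h. L h * a + b * (c * h)) = dbar L * a"
  by (simp add: dbar_def algebra_simps)

lemma real_C1_on_continuous:
  assumes "real_C1_on S Y D" shows "continuous_on S Y"
  using assms unfolding real_C1_on_def
  by (meson continuous_at_imp_continuous_on has_derivative_continuous)

lemma real_C1_on_linear: "real_C1_on S Y D \<Longrightarrow> z \<in> S \<Longrightarrow> linear (D z)"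
  unfolding real_C1_on_def using has_derivative_linear by blast

lemma real_C1_on_continuous_apply:
  assumes "real_C1_on S Y D" "continuous_on T g" "continuous_on T c" "g ` T \<subseteq> S"
  shows "continuous_on T (\<lambda>z. D (g z) (c z))"
proof -
  have "D (g z) (c z) = of_real (Re (c z)) * D (g z) 1 + of_real (Im (c z)) * D (g z) \<i>" if "z \<in> T" for z
    by (rule real_linear_complex[OF real_C1_on_linear[OF assms(1)]]) (use that assms in auto)
  moreover have "continuous_on T (\<lambda>z. of_real (Re (c z)) * D (g z) 1 + of_real (Im (c z)) * D (g z) \<i>)"
    using assms(1) unfolding real_C1_on_def
    by (intro continuous_intros assms(3) continuous_on_compose2[OF _ assms(2,4)]) auto
  ultimately show ?thesis by (simp cong: continuous_on_cong)
qed

lemma real_C1_on_compose_holomorphic: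
  assumes "real_C1_on S Y D" "g holomorphic_on T" "open T" "g ` T \<subseteq> S"
  shows "real_C1_on T (\<lambda>z. Y (g z)) (\<lambda>z h. D (g z) (deriv g z * h))"
  unfolding real_C1_on_def
proof (intro conjI ballI allI)
  fix z assume z: "z \<in> T"
  have "(g has_derivative (*) (deriv g z)) (at z)"
    using holomorphic_derivI[OF assms(2,3) z] by (simp add: has_field_derivative_def)
  moreover have "(Y has_derivative D (g z)) (at (g z))"
    using assms z unfolding real_C1_on_def by auto
  ultimately show "((\<lambda>z. Y (g z)) has_derivative (\<lambda>h. D (g z) (deriv g z * h))) (at z)"
    by (rule has_derivative_compose)
next
  show "continuous_on T (\<lambda>z. D (g z) (deriv g z * h))" for h
    by (intro real_C1_on_continuous_apply[OF assms(1)] continuous_intros assms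
          holomorphic_on_imp_continuous_on holomorphic_deriv)
qed (rule assms)

lemma real_C1_on_times_holomorphic:
  assumes "real_C1_on S Y D" "g holomorphic_on S"
  shows "real_C1_on S (\<lambda>z. Y z * g z) (\<lambda>z h. D z h * g z + Y z * (deriv g z * h))"
  unfolding real_C1_on_def
proof (intro conjI ballI allI)
  show S: "open S" using assms unfolding real_C1_on_def by blast
  fix z assume z: "z \<in> S"
  have "(g has_derivative (*) (deriv g z)) (at z)"
    using holomorphic_derivI[OF assms(2) S z] by (simp add: has_field_derivative_def)
  moreover have "(Y has_derivative D z) (at z)"
    using assms z unfolding real_C1_on_def by auto
  ultimately show "((\<lambda>z. Y z * g z) has_derivative (\<lambda>h. D z h * g z + Y z * (deriv g z * h))) (at z)"
    by (auto intro!: derivative_eq_intros)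
next
  show "continuous_on S (\<lambda>z. D z h * g z + Y z * (deriv g z * h))" for h
    using assms(1) unfolding real_C1_on_def
    by (intro continuous_intros real_C1_on_continuous[OF assms(1)]
          holomorphic_on_imp_continuous_on[OF assms(2)]
          holomorphic_on_imp_continuous_on[OF holomorphic_deriv[OF assms(2)]]) auto
qed

lemma real_C1_on_cnj:
  assumes "real_C1_on S Y D" shows "real_C1_on S (\<lambda>z. cnj (Y z)) (\<lambda>z h. cnj (D z h))"
  using assms unfolding real_C1_on_def
  by (auto intro!: derivative_eq_intros continuous_intros bounded_linear.has_derivative[OF bounded_linear_cnj])

lemma exp_Complex_eq: "exp (Complex s t) = of_real (exp s) * cis t"
  by (simp add: exp_eq_polar)

lemma exp_image_annulus:
  assumes "0 < a" "a < b"
  shows "exp ` {w. ln a < Re w \<and> Re w < ln b \<and> 0 \<le> Im w \<and> Im w < 2 * pi} = annulus a b"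
proof (intro equalityI subsetI)
  fix z assume "z \<in> exp ` {w. ln a < Re w \<and> Re w < ln b \<and> 0 \<le> Im w \<and> Im w < 2 * pi}"
  then obtain w where w: "z = exp w" "ln a < Re w" "Re w < ln b" by auto
  then have "a < exp (Re w)" "exp (Re w) < b"
    using assms exp_less_cancel_iff[of "ln a" "Re w"] exp_less_cancel_iff[of "Re w" "ln b"] by auto
  then show "z \<in> annulus a b" using w by (simp add: annulus_def)
next
  fix z assume z: "z \<in> annulus a b"
  then have nz: "z \<noteq> 0" "0 < norm z" using assms by (auto simp: annulus_def)
  show "z \<in> exp ` {w. ln a < Re w \<and> Re w < ln b \<and> 0 \<le> Im w \<and> Im w < 2 * pi}"
  proof (intro image_eqI[of _ _ "Complex (ln (norm z)) (Arg2pi z)"])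
    show "z = exp (Complex (ln (norm z)) (Arg2pi z))"
      using nz Arg2pi_eq[of z] by (simp add: exp_Complex_eq cis_conv_exp)
  qed (use z nz assms Arg2pi_ge_0 Arg2pi_lt_2pi in \<open>auto simp: annulus_def\<close>)
qed

lemma inj_on_exp_strip: "inj_on exp {w::complex. A < Re w \<and> Re w < B \<and> 0 \<le> Im w \<and> Im w < 2 * pi}"
proof (rule inj_onI, clarsimp)
  fix w z :: complex
  assume *: "exp w = exp z" "0 \<le> Im w" "Im w < 2 * pi" "0 \<le> Im z" "Im z < 2 * pi"
  then have "\<bar>Im w - Im z\<bar> < 2 * pi" by auto
  then show "w = z" using * exp_complex_eqI by blast
qed

text \<open>
  The exponential maps the rectangle \<open>[ln a, ln b] \<times> [0, 2\<pi>)\<close> conformally onto the annulus. For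
  the pulled-back function \<open>Y (exp w) exp w\<close> Green's formula on the rectangle is Fubini and the
  fundamental theorem of calculus: the two horizontal sides cancel by periodicity and the vertical
  ones become the circle integrals.
\<close>

lemma Green_annulus:
  assumes Y: "real_C1_on S Y D" and ab: "0 < a" "a < b" and sub: "{z. a \<le> norm z \<and> norm z \<le> b} \<subseteq> S"
  shows "(\<lambda>z. dbar (D z)) absolutely_integrable_on annulus a b"
    and "integral (annulus a b) (\<lambda>z. dbar (D z)) = circle_integral Y b - circle_integral Y a"
proof -
  \<comment> \<open>the factor \<open>exp w\<close> comes from \<open>dz = exp w dw\<close>\<close>
  define y where "y = (\<lambda>w. Y (exp w) * exp w)"
  define U :: "complex set" where "U = exp -` S"
  define Dy where "Dy = (\<lambda>w h. D (exp w) (exp w * h) * exp w + Y (exp w) * (exp w * h))"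
  let ?s1 = "ln a" and ?s2 = "ln b"
  let ?R = "cbox (Complex ?s1 0) (Complex ?s2 (2 * pi))"
  have S: "open S" using Y unfolding real_C1_on_def by blast
  have U: "open U" unfolding U_def
    by (intro open_vimage S continuous_intros)
  have C: "real_C1_on U y Dy"
    unfolding y_def Dy_def
    using real_C1_on_times_holomorphic[OF real_C1_on_compose_holomorphic[OF Y, of exp U], of exp] U
    by (auto simp: U_def holomorphic_on_exp DERIV_imp_deriv[OF DERIV_exp])
  have RU: "?R \<subseteq> U"
  proof
    fix w assume "w \<in> ?R"
    then have "?s1 \<le> Re w" "Re w \<le> ?s2" by (auto simp: mem_cbox_complex)
    then have "a \<le> exp (Re w)" "exp (Re w) \<le> b"
      using ab exp_le_cancel_iff[of "ln a" "Re w"] exp_le_cancel_iff[of "Re w" "ln b"] by auto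
    then show "w \<in> U" using sub by (auto simp: U_def)
  qed
  have cD: "continuous_on ?R (\<lambda>w. Dy w h)" for h
    using C RU unfolding real_C1_on_def by (meson continuous_on_subset)
  have der: "(y has_derivative Dy w) (at w)" if "w \<in> ?R" for w
    using C RU that unfolding real_C1_on_def by blast
  define f where "f = (\<lambda>w. dbar (Dy w))"
  have f_eq: "f w = of_real ((norm (exp w))\<^sup>2) * dbar (D (exp w))" if "w \<in> U" for w
  proof -
    have l: "linear (D (exp w))" using that real_C1_on_linear[OF Y] by (auto simp: U_def)
    have "f w = cnj (exp w) * dbar (D (exp w)) * exp w"
      unfolding f_def Dy_def dbar_times_holomorphic dbar_compose_holomorphic[OF l] ..
    then show ?thesis by (simp only: complex_norm_square mult_ac)
  qed
  have fc: "continuous_on ?R f" unfolding f_def dbar_def by (intro continuous_intros cD)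
  have ls: "?s1 \<le> ?s2" using ab by simp
  have P1: "integral ?R (\<lambda>w. Dy w 1) = integral {0..2*pi} (\<lambda>t. y (Complex ?s2 t) - y (Complex ?s1 t))"
  proof -
    have "integral {?s1..?s2} (\<lambda>x. Dy (Complex x t) 1) = y (Complex ?s2 t) - y (Complex ?s1 t)"
      if t: "t \<in> {0..2*pi}" for t
    proof (intro integral_unique fundamental_theorem_of_calculus[OF ls])
      fix x assume x: "x \<in> {?s1..?s2}"
      have l: "((\<lambda>x. Complex x t) has_derivative (\<lambda>h. of_real h)) (at x within {?s1..?s2})"
        unfolding Complex_eq by (auto intro!: derivative_eq_intros)
      have m: "Complex x t \<in> ?R" using x t by (auto simp: mem_cbox_complex)
      have "Dy (Complex x t) (of_real h) = h *\<^sub>R Dy (Complex x t) 1" for h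
        using linear_scale[OF has_derivative_linear[OF der[OF m]], of h 1] by (simp add: scaleR_conv_of_real)
      then show "((\<lambda>x. y (Complex x t)) has_vector_derivative Dy (Complex x t) 1) (at x within {?s1..?s2})"
        using has_derivative_compose[OF l der[OF m]] by (simp add: has_vector_derivative_def)
    qed
    then show ?thesis
      unfolding integral_rectangle(2)[OF cD] by (intro integral_cong) auto
  qed
  have P2: "integral ?R (\<lambda>w. Dy w \<i>) = 0"
  proof -
    have "integral {0..2*pi} (\<lambda>t. Dy (Complex x t) \<i>) = y (Complex x (2*pi)) - y (Complex x 0)"
      if x: "x \<in> {?s1..?s2}" for x
    proof (intro integral_unique fundamental_theorem_of_calculus)
      fix t assume t: "t \<in> {0..2*pi}"
      have l: "((\<lambda>t. Complex x t) has_derivative (\<lambda>h. h *\<^sub>R \<i>)) (at t within {0..2*pi})"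
        unfolding Complex_eq by (auto intro!: derivative_eq_intros simp: scaleR_conv_of_real)
      have m: "Complex x t \<in> ?R" using x t by (auto simp: mem_cbox_complex)
      have "Dy (Complex x t) (h *\<^sub>R \<i>) = h *\<^sub>R Dy (Complex x t) \<i>" for h
        using linear_scale[OF has_derivative_linear[OF der[OF m]], of h \<i>] by simp
      then show "((\<lambda>t. y (Complex x t)) has_vector_derivative Dy (Complex x t) \<i>) (at t within {0..2*pi})"
        using has_derivative_compose[OF l der[OF m]] by (simp add: has_vector_derivative_def)
    qed simp
    moreover have "y (Complex x (2*pi)) = y (Complex x 0)" for x
      by (simp add: y_def exp_Complex_eq)
    ultimately have "integral {?s1..?s2} (\<lambda>x. integral {0..2*pi} (\<lambda>t. Dy (Complex x t) \<i>)) = integral {?s1..?s2} (\<lambda>x. 0)"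
      by (intro integral_cong) auto
    then show ?thesis unfolding integral_rectangle(1)[OF cD] by simp
  qed
  have ye: "y (Complex (ln r) t) * \<i> = Y (of_real r * cis t) * (\<i> * of_real r * cis t)" if "r > 0" for r t
    using that by (simp add: y_def exp_Complex_eq)
  have ic: "(\<lambda>t. y (Complex (ln r) t) * \<i>) integrable_on {0..2*pi}" if "a \<le> r" "r \<le> b" for r
  proof (intro integrable_continuous_interval continuous_intros)
    have "continuous_on U y" using real_C1_on_continuous[OF C] .
    then show "continuous_on {0..2*pi} (\<lambda>t. y (Complex (ln r) t))"
      by (rule continuous_on_compose2)
         (use that ab RU in \<open>auto intro!: continuous_intros subsetD[OF RU] simp: Complex_eq mem_cbox_complex\<close>)
  qed
  have "integral ?R f = \<i> * integral ?R (\<lambda>w. Dy w 1) - integral ?R (\<lambda>w. Dy w \<i>)"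
    unfolding f_def dbar_def
    by (subst integral_diff) (auto intro!: integrable_continuous continuous_intros cD)
  also have "\<dots> = integral {0..2*pi} (\<lambda>t. y (Complex ?s2 t) * \<i> - y (Complex ?s1 t) * \<i>)"
    unfolding P1 P2 integral_mult_right[symmetric] by (simp add: algebra_simps)
  also have "\<dots> = circle_integral Y b - circle_integral Y a"
    using ab ic[of a] ic[of b] by (subst integral_diff) (auto simp: circle_integral_def ye)
  finally have main: "integral ?R f = circle_integral Y b - circle_integral Y a" .
  \<comment> \<open>The half-open strip, on which \<open>exp\<close> is injective with image exactly the annulus; it differs
     from the closed rectangle by a null set.\<close>
  define T where "T = {w. ?s1 < Re w \<and> Re w < ?s2 \<and> 0 \<le> Im w \<and> Im w < 2 * pi}"
  define I where "I = box (Complex ?s1 0) (Complex ?s2 (2 * pi))"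
  have T1: "I \<subseteq> T" "T \<subseteq> ?R"
    by (auto simp: I_def T_def mem_cbox_complex mem_box Basis_complex_def)
  have neg: "negligible (?R - I)"
    unfolding I_def by (rule negligible_frontier_interval)
  have "negligible (T - I)"
    by (rule negligible_subset[OF neg Diff_mono[OF T1(2) order_refl]])
  then have "T - I \<in> sets lebesgue" by (rule negligible_imp_sets)
  moreover have "I \<in> sets lebesgue" by (simp add: I_def)
  ultimately have "I \<union> (T - I) \<in> sets lebesgue" by (rule sets.Un[rotated])
  then have Tm: "T \<in> sets lebesgue" using T1(1) by (simp add: Un_absorb1)
  have "f absolutely_integrable_on ?R" by (rule absolutely_integrable_continuous[OF fc])
  then have fT: "f absolutely_integrable_on T" by (rule set_integrable_subset) (use T1 Tm in auto)
  have iT: "integral T f = integral ?R f"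
    by (rule integral_spike_set; rule negligible_subset[OF neg]) (use T1 in blast)+
  have fe: "f w = of_real ((norm (exp w))\<^sup>2) * dbar (D (exp w))" if "w \<in> T" for w
    by (rule f_eq) (rule subsetD[OF RU subsetD[OF T1(2) that]])
  have "(\<lambda>w. of_real ((norm (exp w))\<^sup>2) * dbar (D (exp w))) absolutely_integrable_on T \<and>
      integral T (\<lambda>w. of_real ((norm (exp w))\<^sup>2) * dbar (D (exp w))) = integral ?R f
    \<longleftrightarrow> (\<lambda>z. dbar (D z)) absolutely_integrable_on (exp ` T) \<and> integral (exp ` T) (\<lambda>z. dbar (D z)) = integral ?R f"
  proof (rule conformal_change_of_variables[OF Tm])
    show "(exp has_field_derivative exp w) (at w within T)" for w :: complex
      by (rule DERIV_subset[OF DERIV_exp]) simp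
    show "inj_on exp T" unfolding T_def by (rule inj_on_exp_strip)
  qed
  moreover have "(\<lambda>w. of_real ((norm (exp w))\<^sup>2) * dbar (D (exp w))) absolutely_integrable_on T"
    using fT by (rule set_integrable_cong[THEN iffD1, rotated -1]) (simp_all only: fe)
  moreover have "integral T (\<lambda>w. of_real ((norm (exp w))\<^sup>2) * dbar (D (exp w))) = integral ?R f"
    unfolding iT[symmetric] by (rule integral_cong) (simp only: fe)
  ultimately have "(\<lambda>z. dbar (D z)) absolutely_integrable_on (exp ` T) \<and> integral (exp ` T) (\<lambda>z. dbar (D z)) = integral ?R f"
    by blast
  then show "(\<lambda>z. dbar (D z)) absolutely_integrable_on annulus a b"
    and "integral (annulus a b) (\<lambda>z. dbar (D z)) = circle_integral Y b - circle_integral Y a"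
    unfolding T_def exp_image_annulus[OF ab] main by auto
qed

lemma integral_exhausting_tendsto:
  fixes f :: "complex \<Rightarrow> complex"
  assumes f: "f absolutely_integrable_on T" and A: "\<And>n. A n \<subseteq> T" "\<And>n. open (A n)"
    and ex: "\<And>z. z \<in> T \<Longrightarrow> \<forall>\<^sub>F n in sequentially. z \<in> A n"
  shows "(\<lambda>n. integral (A n) f) \<longlonglongrightarrow> integral T f"
proof -
  have "(\<lambda>n. integral T (\<lambda>z. if z \<in> A n then f z else 0)) \<longlonglongrightarrow> integral T f"
  proof (rule dominated_convergence(2))
    show "(\<lambda>z. if z \<in> A n then f z else 0) integrable_on T" for n
    proof -
      have "f integrable_on A n"
        by (intro set_lebesgue_integral_eq_integral(1) set_integrable_subset[OF f]) (use A in auto)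
      then show ?thesis
        using A(1)[of n] by (simp add: integrable_restrict_Int Int_absorb1 Int_absorb2)
    qed
    show "(\<lambda>z. norm (f z)) integrable_on T" using f by (simp add: absolutely_integrable_on_def)
    show "(\<lambda>n. if z \<in> A n then f z else 0) \<longlonglongrightarrow> f z" if "z \<in> T" for z
      by (rule tendsto_eventually) (use ex[OF that] in eventually_elim, auto)
  qed auto
  moreover have "integral T (\<lambda>z. if z \<in> A n then f z else 0) = integral (A n) f" for n
    using A(1)[of n] by (simp add: integral_restrict_Int Int_absorb1 Int_absorb2)
  ultimately show ?thesis by simp
qed

lemma integral_annulus_tendsto_outer:
  fixes f :: "complex \<Rightarrow> complex"
  assumes "f absolutely_integrable_on outer_disc a"
  shows "((\<lambda>r. integral (annulus a r) f) \<longlongrightarrow> integral (outer_disc a) f) at_top"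
proof (rule tendsto_at_topI_sequentially)
  fix X :: "nat \<Rightarrow> real" assume X: "filterlim X at_top sequentially"
  show "(\<lambda>n. integral (annulus a (X n)) f) \<longlonglongrightarrow> integral (outer_disc a) f"
  proof (rule integral_exhausting_tendsto[OF assms])
    show "\<forall>\<^sub>F n in sequentially. z \<in> annulus a (X n)" if "z \<in> outer_disc a" for z
      using X that unfolding filterlim_at_top_dense annulus_def outer_disc_def by simp
  qed (auto simp: annulus_def outer_disc_def open_annulus[unfolded annulus_def])
qed

text \<open>
  The inner circle may be the edge of the domain of \<open>Y\<close>, where nothing is known about derivatives,
  or a single point (\<open>a = 0\<close>), so its contribution is only required to vanish in the limit.
\<close>

lemma Green_annulus_vanishing_inner:
  assumes Y: "real_C1_on S Y D" and ab: "0 \<le> a" "a < b" and sub: "{z. a < norm z \<and> norm z \<le> b} \<subseteq> S"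
    and int: "(\<lambda>z. dbar (D z)) absolutely_integrable_on annulus a b"
    and lim: "(circle_integral Y \<longlongrightarrow> 0) (at_right a)"
  shows "integral (annulus a b) (\<lambda>z. dbar (D z)) = circle_integral Y b"
proof -
  define r where "r = (\<lambda>n::nat. a + (b - a) / (2 + real n))"
  have r: "a < r n" "r n < b" for n
  proof -
    have "(b - a) / (2 + real n) < (b - a) / 1" using ab by (intro divide_strict_left_mono) auto
    then show "r n < b" by (simp add: r_def)
  qed (use ab in \<open>simp add: r_def add_nonneg_pos\<close>)
  have "r \<longlonglongrightarrow> a + 0" unfolding r_def
    by (intro tendsto_add tendsto_const real_tendsto_divide_at_top[where c = "b - a"]
          filterlim_tendsto_add_at_top[OF tendsto_const filterlim_real_sequentially])
  then have ra: "r \<longlonglongrightarrow> a" by simp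
  have 1: "(\<lambda>n. integral (annulus (r n) b) (\<lambda>z. dbar (D z))) \<longlonglongrightarrow> integral (annulus a b) (\<lambda>z. dbar (D z))"
  proof (rule integral_exhausting_tendsto[OF int])
    show "\<forall>\<^sub>F n in sequentially. z \<in> annulus (r n) b" if "z \<in> annulus a b" for z
      using order_tendstoD(2)[OF ra, of "norm z"] that unfolding annulus_def by simp
    show "annulus (r n) b \<subseteq> annulus a b" for n using r[of n] by (auto simp: annulus_def)
  qed (rule open_annulus)
  have "integral (annulus (r n) b) (\<lambda>z. dbar (D z)) = circle_integral Y b - circle_integral Y (r n)" for n
    by (rule Green_annulus(2)[OF Y]) (use r[of n] ab sub in auto)
  then have 1: "(\<lambda>n. circle_integral Y b - circle_integral Y (r n)) \<longlonglongrightarrow> integral (annulus a b) (\<lambda>z. dbar (D z))"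
    using 1 by simp
  have "filterlim r (at_right a) sequentially"
    using ra r(1) by (auto simp: filterlim_at eventually_sequentially)
  then have "(\<lambda>n. circle_integral Y (r n)) \<longlonglongrightarrow> 0"
    using filterlim_compose[OF lim] by auto
  then have "(\<lambda>n. circle_integral Y b - circle_integral Y (r n)) \<longlonglongrightarrow> circle_integral Y b - 0"
    by (intro tendsto_intros)
  from LIMSEQ_unique[OF 1 this] show ?thesis by simp
qed

lemma norm_circle_integral_le:
  assumes "r \<ge> 0" "M \<ge> 0" "\<And>z. norm z = r \<Longrightarrow> norm (Y z) \<le> M"
  shows "norm (circle_integral Y r) \<le> 2 * pi * r * M"
proof -
  let ?f = "\<lambda>\<theta>. Y (of_real r * cis \<theta>) * (\<i> * of_real r * cis \<theta>)"
  have "norm (integral {0..2*pi} ?f) \<le> (r * M) * (2 * pi - 0)"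
  proof (cases "?f integrable_on {0..2*pi}")
    case True
    have "norm (?f \<theta>) \<le> r * M" for \<theta>
      using assms(3)[of "of_real r * cis \<theta>"] assms(1) mult_left_mono[OF _ assms(1), of "norm (Y (of_real r * cis \<theta>))" M]
      by (simp add: norm_mult mult.commute)
    then have "norm (integral {0..2*pi} ?f) \<le> integral {0..2*pi} (\<lambda>_. r * M)"
      by (intro integral_norm_bound_integral[OF True]) auto
    then show ?thesis by (simp add: mult_ac)
  qed (use assms in \<open>simp add: not_integrable_integral\<close>)
  also have "(r * M) * (2 * pi - 0) = 2 * pi * r * M" by simp
  finally show ?thesis unfolding circle_integral_def .
qed

lemma circle_integrable:
  assumes "continuous_on (sphere 0 r) Y" "r \<ge> 0"
  shows "(\<lambda>\<theta>. Y (of_real r * cis \<theta>) * (\<i> * of_real r * cis \<theta>)) integrable_on {0..2 * pi}"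
  by (intro integrable_continuous_interval continuous_intros continuous_on_compose2[OF assms(1)])
     (use assms in \<open>auto simp: norm_mult intro!: continuous_intros\<close>)

lemma circle_integral_diff:
  assumes "continuous_on (sphere 0 r) Y" "continuous_on (sphere 0 r) Z" "r \<ge> 0"
  shows "circle_integral Y r - circle_integral Z r = circle_integral (\<lambda>z. Y z - Z z) r"
  unfolding circle_integral_def
  unfolding integral_diff[OF circle_integrable[OF assms(1,3)] circle_integrable[OF assms(2,3)], symmetric]
  by (simp only: left_diff_distrib)

lemma circle_integral_cong:
  assumes "\<And>z. norm z = r \<Longrightarrow> Y z = Z z" "r \<ge> 0"
  shows "circle_integral Y r = circle_integral Z r"
  unfolding circle_integral_def by (intro integral_cong) (use assms in \<open>auto simp: norm_mult\<close>)

section \<open>A smooth truncation of vectors near zero\<close>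

text \<open>
  A \<open>C\<^sup>1\<close> step from \<open>0\<close> on \<open>{..1}\<close> to the limit \<open>1\<close> at infinity. Written with \<open>max 1 x\<close>, its
  continuity is automatic, and the quantity \<open>x ramp'(x)\<close>, which controls the derivative of
  the truncation below, is bounded and tends to \<open>0\<close>.
\<close>

definition ramp :: "real \<Rightarrow> real" where "ramp x = (1 - 1 / max 1 x)\<^sup>2"

definition ramp' :: "real \<Rightarrow> real" where "ramp' x = 2 * (1 - 1 / max 1 x) / (max 1 x)\<^sup>2"

lemma ramp_has_derivative: "(ramp has_real_derivative ramp' x) (at x)"
proof (cases x "1::real" rule: linorder_cases)
  case less
  have "(ramp has_real_derivative 0) (at x)"
  proof (rule has_field_derivative_transform_within_open[OF DERIV_const[of 0]])
    show "x \<in> {..<1}" using less by simp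
  qed (auto simp: ramp_def)
  then show ?thesis using less by (simp add: ramp'_def)
next
  case greater
  have "((\<lambda>x. (1 - 1 / x)\<^sup>2) has_real_derivative ramp' x) (at x)"
    using greater by (auto intro!: derivative_eq_intros simp: ramp'_def field_simps power2_eq_square)
  then show ?thesis
    by (rule has_field_derivative_transform_within_open[of _ _ _ "{1<..}"])
       (use greater in \<open>auto simp: ramp_def\<close>)
next
  case equal
  have b: "norm ((ramp y - ramp 1) / (y - 1)) \<le> \<bar>y - 1\<bar>" if "y \<noteq> 1" for y
  proof -
    have "0 \<le> 1 - 1 / max 1 y" "1 - 1 / max 1 y \<le> \<bar>y - 1\<bar>"
    proof -
      show "0 \<le> 1 - 1 / max 1 y" by (simp add: field_simps)
      show "1 - 1 / max 1 y \<le> \<bar>y - 1\<bar>"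
      proof (cases "y \<le> 1")
        case False
        then show ?thesis using frac_le[of "y - 1" "y - 1" 1 y] by (simp add: max_def diff_divide_distrib)
      qed (simp add: max_def)
    qed
    then have "ramp y \<le> \<bar>y - 1\<bar>\<^sup>2" unfolding ramp_def by (intro power_mono)
    then show ?thesis using that
      by (simp add: ramp_def power2_eq_square abs_divide divide_le_eq) 
  qed
  have "(\<lambda>y::real. \<bar>y - 1\<bar>) \<midarrow>1\<rightarrow> 0" by (auto intro!: tendsto_eq_intros)
  then have "(\<lambda>y. (ramp y - ramp 1) / (y - 1)) \<midarrow>1\<rightarrow> 0"
    by (rule Lim_null_comparison[rotated]) (use b in \<open>auto simp: eventually_at_filter\<close>)
  then show ?thesis using equal by (simp add: has_field_derivative_iff ramp'_def)
qed

lemma continuous_ramp: "continuous_on UNIV ramp" "continuous_on UNIV ramp'"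
  unfolding ramp_def[abs_def] ramp'_def[abs_def] by (auto intro!: continuous_intros)

lemma ramp_bounds: "0 \<le> ramp x" "ramp x \<le> 1" "0 \<le> ramp' x" "x * ramp' x \<le> 2"
proof -
  have *: "0 \<le> 1 - 1 / max 1 x" "1 - 1 / max 1 x \<le> 1" by (simp_all add: field_simps)
  show "0 \<le> ramp x" "ramp x \<le> 1" using * by (auto simp: ramp_def power_le_one)
  show p: "0 \<le> ramp' x" unfolding ramp'_def using *(1) by (intro divide_nonneg_nonneg mult_nonneg_nonneg) auto
  show "x * ramp' x \<le> 2"
  proof (cases "x \<le> 1")
    case False
    then have "x * ramp' x = 2 * ((1 - 1 / x) * (1 / x))" by (simp add: ramp'_def power2_eq_square)
    also have "(1 - 1 / x) * (1 / x) \<le> 1 * 1" using False by (intro mult_mono) auto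
    finally show ?thesis by simp
  qed (simp add: ramp'_def max_def)
qed

lemma ramp_limits: "(ramp \<longlongrightarrow> 1) at_top" "((\<lambda>x. x * ramp' x) \<longlongrightarrow> 0) at_top"
proof -
  have i: "((\<lambda>x::real. 1 / x) \<longlongrightarrow> 0) at_top"
    by (rule tendsto_divide_0[OF tendsto_const filterlim_at_top_imp_at_infinity[OF filterlim_ident]])
  have "((\<lambda>x::real. (1 - 1 / x)\<^sup>2) \<longlongrightarrow> (1 - 0)\<^sup>2) at_top"
    by (intro tendsto_intros i)
  moreover have "\<forall>\<^sub>F x in at_top. (1 - 1 / x)\<^sup>2 = ramp x"
    using eventually_gt_at_top[of "1::real"] by eventually_elim (simp add: ramp_def)
  ultimately have "(ramp \<longlongrightarrow> (1 - 0)\<^sup>2) at_top" by (rule Lim_transform_eventually)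
  then show "(ramp \<longlongrightarrow> 1) at_top" by simp
  have "((\<lambda>x::real. 2 * (1 - 1 / x) * (1 / x)) \<longlongrightarrow> 2 * (1 - 0) * 0) at_top"
    by (intro tendsto_intros i)
  moreover have "\<forall>\<^sub>F x in at_top. 2 * (1 - 1 / x) * (1 / x) = x * ramp' x"
    using eventually_gt_at_top[of "1::real"]
    by eventually_elim (simp add: ramp'_def power2_eq_square)
  ultimately have "((\<lambda>x. x * ramp' x) \<longlongrightarrow> 2 * (1 - 0) * 0) at_top" by (rule Lim_transform_eventually)
  then show "((\<lambda>x. x * ramp' x) \<longlongrightarrow> 0) at_top" by simp
qed

text \<open>
  Vectors with \<open>n|u|\<^sup>2 \<le> 1\<close> are replaced by \<open>0\<close>, long vectors are hardly changed. The factor depends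
  on the length of \<open>u\<close>, not on the coordinates separately: as \<open>n\<close> grows the differential then
  tends to the identity wherever \<open>u \<noteq> 0\<close>, so that the divergence of the truncated field
  tends to that of the field itself.
\<close>

definition truncate :: "real \<Rightarrow> complex \<Rightarrow> complex" where
  "truncate n u = of_real (ramp (n * (norm u)\<^sup>2)) * u"

definition truncate' :: "real \<Rightarrow> complex \<Rightarrow> complex \<Rightarrow> complex" where
  "truncate' n u h = of_real (ramp (n * (norm u)\<^sup>2)) * h + of_real (ramp' (n * (norm u)\<^sup>2) * (n * (2 * (u \<bullet> h)))) * u"

lemma truncate_near_0:
  assumes "n * (norm u)\<^sup>2 \<le> 1" shows "truncate n u = 0" "truncate' n u h = 0"
  using assms by (simp_all add: truncate_def truncate'_def ramp_def ramp'_def max_def)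

lemma real_C1_on_truncate: "real_C1_on UNIV (truncate n) (truncate' n)"
  unfolding real_C1_on_def
proof (intro conjI ballI allI)
  fix u :: complex
  have "((\<lambda>u. n * (norm u)\<^sup>2) has_derivative (\<lambda>h. n * (2 * (u \<bullet> h)))) (at u)"
    unfolding power2_norm_eq_inner by (auto intro!: derivative_eq_intros simp: inner_commute)
  from DERIV_compose_FDERIV[OF ramp_has_derivative this]
  have "((\<lambda>u. ramp (n * (norm u)\<^sup>2)) has_derivative (\<lambda>h. n * (2 * (u \<bullet> h)) * ramp' (n * (norm u)\<^sup>2))) (at u)" .
  then show "(truncate n has_derivative truncate' n u) (at u)"
    unfolding truncate_def[abs_def] truncate'_def[abs_def]
    by (auto intro!: derivative_eq_intros simp: mult_ac)
  show "continuous_on UNIV (\<lambda>u. truncate' n u h)" for h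
    unfolding truncate'_def
    by (intro continuous_intros continuous_on_compose2[OF continuous_ramp(1)] continuous_on_compose2[OF continuous_ramp(2)]) auto
qed simp

text \<open>
  Uniformity in \<open>n\<close> is the point: it provides the majorant for dominated convergence.
\<close>

lemma norm_truncate'_le:
  assumes "n \<ge> 0" shows "norm (truncate' n u h) \<le> 5 * norm h"
proof -
  let ?x = "n * (norm u)\<^sup>2"
  have "norm (of_real (ramp ?x) * h) \<le> 1 * norm h"
    unfolding norm_mult using ramp_bounds[of ?x] by (intro mult_right_mono) auto
  moreover have "norm (of_real (ramp' ?x * (n * (2 * (u \<bullet> h)))) * u) \<le> 4 * norm h"
  proof -
    have "norm (of_real (ramp' ?x * (n * (2 * (u \<bullet> h)))) * u) = 2 * ramp' ?x * n * norm u * \<bar>u \<bullet> h\<bar>"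
      using ramp_bounds(3)[of ?x] assms by (simp add: norm_mult abs_mult)
    also have "\<dots> \<le> 2 * ramp' ?x * n * norm u * (norm u * norm h)"
      using ramp_bounds(3)[of ?x] assms by (intro mult_left_mono Cauchy_Schwarz_ineq2) auto
    also have "\<dots> = 2 * (?x * ramp' ?x) * norm h" by (simp add: power2_eq_square)
    also have "\<dots> \<le> 2 * 2 * norm h" using ramp_bounds(4)[of ?x] by (intro mult_right_mono mult_left_mono) auto
    finally show ?thesis by simp
  qed
  ultimately show ?thesis unfolding truncate'_def by (intro order_trans[OF norm_triangle_ineq]) simp
qed

lemma norm_truncate_le: "norm (truncate n u) \<le> norm u"
  unfolding truncate_def norm_mult using ramp_bounds[of "n * (norm u)\<^sup>2"]
  by (simp add: mult_left_le_one_le)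

text \<open>
  At \<open>u = 0\<close> the differentials vanish for all \<open>n\<close>. This is why the area formulas below
  involve the vorticity on \<open>{z. V z \<noteq> 0}\<close> only.
\<close>

lemma truncate_limits:
  shows "(\<lambda>n. truncate (real n) u) \<longlonglongrightarrow> u"
    and "(\<lambda>n. truncate' (real n) u h) \<longlonglongrightarrow> (if u = 0 then 0 else h)"
proof -
  have f: "filterlim (\<lambda>n. real n * (norm u)\<^sup>2) at_top sequentially" if "u \<noteq> 0"
    using that by (intro filterlim_at_top_mult_tendsto_pos[OF tendsto_const] filterlim_real_sequentially
        filterlim_tendsto_pos_mult_at_top) (auto simp: mult.commute)
  note r1 = filterlim_compose[OF ramp_limits(1) f] and r2 = filterlim_compose[OF ramp_limits(2) f]
  show "(\<lambda>n. truncate (real n) u) \<longlonglongrightarrow> u"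
  proof (cases "u = 0")
    case False
    have "(\<lambda>n. truncate (real n) u) \<longlonglongrightarrow> of_real 1 * u"
      unfolding truncate_def by (intro tendsto_intros r1 False)
    then show ?thesis by simp
  qed (simp add: truncate_def)
  show "(\<lambda>n. truncate' (real n) u h) \<longlonglongrightarrow> (if u = 0 then 0 else h)"
  proof (cases "u = 0")
    case False
    have eq: "ramp' (real n * (norm u)\<^sup>2) * (real n * (2 * (u \<bullet> h)))
        = (real n * (norm u)\<^sup>2 * ramp' (real n * (norm u)\<^sup>2)) * (2 * (u \<bullet> h) / (norm u)\<^sup>2)" for n
      using False by simp
    have "(\<lambda>n. truncate' (real n) u h) \<longlonglongrightarrow> of_real 1 * h + of_real (0 * (2 * (u \<bullet> h) / (norm u)\<^sup>2)) * u"
      unfolding truncate'_def eq by (intro tendsto_intros r1 r2 False)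
    then show ?thesis using False by simp
  qed (simp add: truncate_near_0)
qed

section \<open>The exterior conformal map\<close>

locale exterior_map =
  fixes r0 :: real and \<Omega> :: "complex set" and \<Phi> :: "complex \<Rightarrow> complex"
  assumes r0: "r0 > 0" and closed: "closed \<Omega>" and bounded_compl: "bounded (- \<Omega>)"
    and riemann: "exterior_riemann_map r0 \<Omega> \<Phi>"
begin

abbreviation "G \<equiv> riemann_inv \<Omega> \<Phi>"
abbreviation "E \<equiv> outer_disc r0"

lemma open_E: "open E"
  unfolding outer_disc_def by (intro open_Collect_less continuous_intros)

lemma nonzero_E: "\<zeta> \<in> E \<Longrightarrow> \<zeta> \<noteq> 0"
  using r0 by (auto simp: outer_disc_def)

lemma
  shows \<Phi>_holo: "\<Phi> holomorphic_on interior \<Omega>" and \<Phi>_inj: "inj_on \<Phi> (interior \<Omega>)"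
    and \<Phi>_image: "\<Phi> ` interior \<Omega> = E"
  using riemann by (auto simp: exterior_riemann_map_def bij_betw_def)

lemma G_in: "\<zeta> \<in> E \<Longrightarrow> G \<zeta> \<in> interior \<Omega>"
  using \<Phi>_image by (metis inv_into_into)

lemma \<Phi>_G: "\<zeta> \<in> E \<Longrightarrow> \<Phi> (G \<zeta>) = \<zeta>"
  using \<Phi>_image by (metis f_inv_into_f)

lemma G_\<Phi>: "z \<in> interior \<Omega> \<Longrightarrow> G (\<Phi> z) = z"
  using \<Phi>_inj by (rule inv_into_f_f)

lemma \<Phi>_in: "z \<in> interior \<Omega> \<Longrightarrow> \<Phi> z \<in> E"
  using \<Phi>_image by blast

lemma G_image: "G ` E = interior \<Omega>"
  using G_in \<Phi>_in G_\<Phi> by (metis (no_types, lifting) image_subsetI image_eqI subsetI subset_antisym)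

lemma inj_G: "inj_on G E"
  using \<Phi>_G by (metis inj_onI)

lemma G_holo: "G holomorphic_on E"
  and deriv_\<Phi>_G: "\<zeta> \<in> E \<Longrightarrow> deriv \<Phi> (G \<zeta>) * deriv G \<zeta> = 1"
proof -
  obtain g where g: "g holomorphic_on (\<Phi> ` interior \<Omega>)"
      "\<And>z. z \<in> interior \<Omega> \<Longrightarrow> deriv \<Phi> z * deriv g (\<Phi> z) = 1"
      "\<And>z. z \<in> interior \<Omega> \<Longrightarrow> g (\<Phi> z) = z"
    using holomorphic_has_inverse[OF \<Phi>_holo open_interior \<Phi>_inj] by metis
  have eq: "g \<zeta> = G \<zeta>" if "\<zeta> \<in> E" for \<zeta>
    using g(3)[OF G_in[OF that]] \<Phi>_G[OF that] by simp
  show "G holomorphic_on E"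
    using g(1) unfolding \<Phi>_image by (rule holomorphic_transform) (rule eq)
  assume z: "\<zeta> \<in> E"
  have "deriv g \<zeta> = deriv G \<zeta>"
    by (rule complex_derivative_transform_within_open[of g E]) (use g(1) \<Phi>_image open_E \<open>G holomorphic_on E\<close> z eq in auto)
  then show "deriv \<Phi> (G \<zeta>) * deriv G \<zeta> = 1"
    using g(2)[OF G_in[OF z]] \<Phi>_G[OF z] by simp
qed

lemma G_derivative: "\<zeta> \<in> E \<Longrightarrow> (G has_field_derivative deriv G \<zeta>) (at \<zeta>)"
  using holomorphic_derivI[OF G_holo open_E] .

lemma continuous_on_G: "continuous_on E G" "continuous_on E (deriv G)"
  by (auto intro!: holomorphic_on_imp_continuous_on G_holo holomorphic_deriv open_E)

lemma near_infinity:
  obtains C M where "C \<ge> 0" "M \<ge> 1"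
    "\<And>z. norm z \<ge> M \<Longrightarrow> z \<in> interior \<Omega>"
    "\<And>z. norm z \<ge> M \<Longrightarrow> norm (\<Phi> z - z) \<le> 1"
    "\<And>z. norm z \<ge> M \<Longrightarrow> norm (deriv \<Phi> z - 1) \<le> C / (norm z)\<^sup>2"
    "\<And>z. norm z \<ge> M \<Longrightarrow> norm (deriv \<Phi> z - 1) \<le> 1 / 2"
proof -
  obtain c where c: "c > 0" "\<forall>\<^sub>F z in at_infinity. norm (\<Phi> z - z) \<le> c * norm (1 / z)"
    using riemann unfolding exterior_riemann_map_def by (auto elim!: landau_o.bigE)
  obtain d where d: "d > 0" "\<forall>\<^sub>F z in at_infinity. norm (deriv \<Phi> z - 1) \<le> d * norm (1 / z ^ 2)"
    using riemann unfolding exterior_riemann_map_def by (auto elim!: landau_o.bigE)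
  obtain b1 where b1: "\<And>z. norm z \<ge> b1 \<Longrightarrow> norm (\<Phi> z - z) \<le> c * norm (1 / z)"
    using c(2) by (auto simp: eventually_at_infinity)
  obtain b2 where b2: "\<And>z. norm z \<ge> b2 \<Longrightarrow> norm (deriv \<Phi> z - 1) \<le> d * norm (1 / z ^ 2)"
    using d(2) by (auto simp: eventually_at_infinity)
  have "bounded (closure (- \<Omega>))" by (rule bounded_closure[OF bounded_compl])
  then obtain b3 where b3: "\<And>z. z \<notin> interior \<Omega> \<Longrightarrow> norm z \<le> b3"
    unfolding bounded_iff by (auto simp: closure_complement)
  \<comment> \<open>\<open>M \<ge> c\<close> and \<open>M \<ge> 2 * d\<close> turn the bounds \<open>c / |z|\<close> and \<open>d / |z|\<^sup>2\<close> into \<open>1\<close> and \<open>1 / 2\<close>\<close>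
  define M where "M = Max {1, b1, b2, b3 + 1, c, 2 * d}"
  have M: "1 \<le> M" "b1 \<le> M" "b2 \<le> M" "b3 + 1 \<le> M" "c \<le> M" "2 * d \<le> M"
    unfolding M_def by auto
  have 1: "norm (\<Phi> z - z) \<le> 1" if "norm z \<ge> M" for z
  proof -
    have "norm (\<Phi> z - z) \<le> c / norm z" using b1[of z] M that by (simp add: norm_divide)
    also have "\<dots> \<le> 1" using M that by (simp add: divide_le_eq)
    finally show ?thesis .
  qed
  have 2: "norm (deriv \<Phi> z - 1) \<le> d / (norm z)\<^sup>2" if "norm z \<ge> M" for z
    using b2[of z] M that by (simp add: norm_divide norm_power)
  have 3: "d / (norm z)\<^sup>2 \<le> 1 / 2" if "norm z \<ge> M" for z
  proof -
    have "1 * norm z \<le> norm z * norm z" using that M by (intro mult_right_mono) auto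
    then show ?thesis using that M by (simp add: divide_le_eq power2_eq_square)
  qed
  show ?thesis
  proof (rule that[of d M])
    show "z \<in> interior \<Omega>" if "norm z \<ge> M" for z using b3[of z] M that by linarith
    show "norm (deriv \<Phi> z - 1) \<le> 1 / 2" if "norm z \<ge> M" for z using 2[OF that] 3[OF that] by linarith
  qed (use d M 1 2 in auto)
qed

text \<open>
  That \<open>G \<zeta>\<close> is close to \<open>\<zeta>\<close> needs an argument, because a priori \<open>\<Phi>\<close> might send points close to \<open>\<partial>\<Omega>\<close>
  far out. The map \<open>z \<mapsto> \<zeta> - (\<Phi> z - z)\<close> sends the closed unit disc about \<open>\<zeta>\<close> into itself once
  \<open>|\<zeta>|\<close> is large, and its Brouwer fixed point is a preimage of \<open>\<zeta>\<close>, hence equal to \<open>G \<zeta>\<close>.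
\<close>

lemma inverse_near_infinity:
  obtains C M where "C \<ge> 0" "M \<ge> 1" "r0 < M"
    "\<And>\<zeta>. norm \<zeta> \<ge> M \<Longrightarrow> norm (G \<zeta> - \<zeta>) \<le> 1"
    "\<And>\<zeta>. norm \<zeta> \<ge> M \<Longrightarrow> norm (deriv G \<zeta> - 1) \<le> C / (norm \<zeta>)\<^sup>2"
    "\<And>\<zeta>. norm \<zeta> \<ge> M \<Longrightarrow> norm (deriv G \<zeta>) \<le> 2"
    "\<And>\<zeta>. \<zeta> \<in> E \<Longrightarrow> norm (G \<zeta>) \<le> max M (norm \<zeta> + 1)"
proof -
  obtain C M where C: "C \<ge> 0" and M: "M \<ge> 1" "\<And>z. norm z \<ge> M \<Longrightarrow> z \<in> interior \<Omega>"
    "\<And>z. norm z \<ge> M \<Longrightarrow> norm (\<Phi> z - z) \<le> 1"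
    "\<And>z. norm z \<ge> M \<Longrightarrow> norm (deriv \<Phi> z - 1) \<le> C / (norm z)\<^sup>2"
    "\<And>z. norm z \<ge> M \<Longrightarrow> norm (deriv \<Phi> z - 1) \<le> 1 / 2"
    using near_infinity by blast
  \<comment> \<open>the unit disc about \<open>\<zeta>\<close> must lie where the estimates hold, and \<open>\<zeta>\<close> itself in \<open>E\<close>\<close>
  define N where "N = M + 1 + r0"
  have 1: "norm (G \<zeta> - \<zeta>) \<le> 1" if "norm \<zeta> \<ge> N" for \<zeta>
  proof -
    have far: "norm z \<ge> M" if "z \<in> cball \<zeta> 1" for z
      using that \<open>norm \<zeta> \<ge> N\<close> r0 norm_triangle_ineq2[of \<zeta> z] by (auto simp: N_def dist_norm)
    obtain z where "z \<in> cball \<zeta> 1" "\<zeta> - (\<Phi> z - z) = z"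
    proof (rule brouwer[of "cball \<zeta> 1" "\<lambda>z. \<zeta> - (\<Phi> z - z)"])
      show "continuous_on (cball \<zeta> 1) (\<lambda>z. \<zeta> - (\<Phi> z - z))"
        by (intro continuous_intros holomorphic_on_imp_continuous_on holomorphic_on_subset[OF \<Phi>_holo])
           (use far M(2) in auto)
      show "(\<lambda>z. \<zeta> - (\<Phi> z - z)) \<in> cball \<zeta> 1 \<rightarrow> cball \<zeta> 1"
        using far M(3) by (auto simp: dist_norm)
    qed auto
    then have z: "z \<in> cball \<zeta> 1" "\<Phi> z = \<zeta>" by (auto simp: algebra_simps)
    then have "G \<zeta> = z" using G_\<Phi>[OF M(2)[OF far[OF z(1)]]] by simp
    then show ?thesis using z(1) by (simp add: dist_norm norm_minus_commute)
  qed
  have inE: "\<zeta> \<in> E" if "norm \<zeta> \<ge> N" for \<zeta>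
    using that M(1) by (auto simp: N_def outer_disc_def)
  have G: "norm (G \<zeta>) \<ge> M" "norm (G \<zeta>) \<ge> norm \<zeta> / 2" if "norm \<zeta> \<ge> N" for \<zeta>
    using 1[OF that] that M(1) r0 norm_triangle_ineq2[of \<zeta> "G \<zeta>"]
    by (auto simp: N_def norm_minus_commute)
  have d: "norm (deriv G \<zeta>) \<le> 2" "norm (deriv G \<zeta> - 1) \<le> 2 * norm (deriv \<Phi> (G \<zeta>) - 1)"
    if "norm \<zeta> \<ge> N" for \<zeta>
  proof -
    let ?p = "deriv \<Phi> (G \<zeta>)"
    have m: "?p * deriv G \<zeta> = 1" using deriv_\<Phi>_G[OF inE[OF that]] .
    have "norm ?p \<ge> 1 / 2"
      using M(5)[OF G(1)[OF that]] norm_triangle_ineq2[of 1 ?p] by (simp add: norm_minus_commute)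
    moreover have "norm ?p * norm (deriv G \<zeta>) = 1" using m by (metis norm_mult norm_one)
    ultimately have "1 / 2 * norm (deriv G \<zeta>) \<le> 1" by (metis mult_right_mono norm_ge_zero)
    then show *: "norm (deriv G \<zeta>) \<le> 2" by simp
    have "deriv G \<zeta> - 1 = - (deriv G \<zeta> * (?p - 1))" using m by (simp add: algebra_simps)
    then have "norm (deriv G \<zeta> - 1) = norm (deriv G \<zeta>) * norm (?p - 1)" by (simp add: norm_mult)
    also have "\<dots> \<le> 2 * norm (?p - 1)" using * by (intro mult_right_mono) auto
    finally show "norm (deriv G \<zeta> - 1) \<le> 2 * norm (?p - 1)" .
  qed
  show ?thesis
  proof (rule that[of "8 * C" N])
    show "norm (deriv G \<zeta> - 1) \<le> 8 * C / (norm \<zeta>)\<^sup>2" if "norm \<zeta> \<ge> N" for \<zeta>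
    proof -
      have pos: "norm \<zeta> > 0" using that M(1) r0 unfolding N_def by linarith
      have "norm (deriv G \<zeta> - 1) \<le> 2 * (C / (norm (G \<zeta>))\<^sup>2)"
        using d(2)[OF that] M(4)[OF G(1)[OF that]] by linarith
      also have "C / (norm (G \<zeta>))\<^sup>2 \<le> C / (norm \<zeta> / 2)\<^sup>2"
        using G(2)[OF that] pos C
        by (intro divide_left_mono power_mono mult_pos_pos zero_less_power) auto
      finally show ?thesis by (simp add: power_divide)
    qed
    show "norm (G \<zeta>) \<le> max N (norm \<zeta> + 1)" if "\<zeta> \<in> E" for \<zeta>
    proof (cases "norm (G \<zeta>) \<ge> M")
      case True
      from M(3)[OF this] \<Phi>_G[OF that] have "norm (\<zeta> - G \<zeta>) \<le> 1" by simp
      then show ?thesis using norm_triangle_ineq2[of "G \<zeta>" \<zeta>] by (simp add: norm_minus_commute)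
    qed (use r0 in \<open>auto simp: N_def\<close>)
  qed (use C M(1) r0 1 d(1) in \<open>auto simp: N_def\<close>)
qed

lemma G_at_infinity: "filterlim G at_infinity at_infinity"
proof -
  obtain C M where M: "\<And>\<zeta>. norm \<zeta> \<ge> M \<Longrightarrow> norm (G \<zeta> - \<zeta>) \<le> 1"
    using inverse_near_infinity by metis
  show ?thesis
    unfolding filterlim_at_infinity[OF order_refl] eventually_at_infinity
  proof (intro allI impI)
    fix r :: real assume "r > 0"
    show "\<exists>b. \<forall>x. b \<le> norm x \<longrightarrow> r \<le> norm (G x)"
    proof (intro exI allI impI)
      fix x :: complex assume "max M (r + 1) \<le> norm x"
      then show "r \<le> norm (G x)" using M[of x] norm_triangle_ineq2[of x "G x"] by (simp add: norm_minus_commute)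
    qed
  qed
qed

text \<open>
  Properness of \<open>\<Phi>\<close>: the points of a bounded part of \<open>\<Omega>\<close> with \<open>|V| \<ge> e\<close> form a compact set, which the no-slip
  condition keeps away from \<open>\<partial>\<Omega>\<close>. Its image under \<open>\<Phi>\<close> is compact in the open set \<open>|\<zeta>| > r0\<close> and so
  has a positive distance from the circle \<open>|\<zeta>| = r0\<close>. A bounded part suffices, because \<open>G\<close> is
  bounded near that circle.
\<close>

lemma vanishing_at_inner_circle:
  fixes V :: "complex \<Rightarrow> complex"
  assumes V: "continuous_on \<Omega> V" "no_slip \<Omega> V" and e: "e > 0"
  obtains d where "d > 0" "\<And>\<zeta>. r0 < norm \<zeta> \<Longrightarrow> norm \<zeta> < r0 + d \<Longrightarrow> norm (V (G \<zeta>)) < e"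
proof -
  obtain M where M: "r0 < M" "\<And>\<zeta>. \<zeta> \<in> E \<Longrightarrow> norm (G \<zeta>) \<le> max M (norm \<zeta> + 1)"
    using inverse_near_infinity by metis
  define K where "K = {z \<in> \<Omega>. e \<le> norm (V z)} \<inter> cball 0 (max M (r0 + 2))"
  have "closed {z \<in> \<Omega>. e \<le> norm (V z)}"
    using continuous_closed_preimage[of \<Omega> "\<lambda>z. norm (V z)" "{e..}"] V(1) closed
    by (auto simp: vimage_def Int_def intro!: continuous_intros)
  then have K: "compact K" unfolding K_def by (intro closed_Int_compact) auto
  have KI: "K \<subseteq> interior \<Omega>"
  proof
    fix z assume z: "z \<in> K"
    then have "z \<notin> frontier \<Omega>" using V(2) e by (auto simp: K_def no_slip_def)
    moreover have "z \<in> closure \<Omega>" using z closure_subset by (auto simp: K_def)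
    ultimately show "z \<in> interior \<Omega>" by (auto simp: frontier_def)
  qed
  have "compact (\<Phi> ` K)"
    by (intro compact_continuous_image K holomorphic_on_imp_continuous_on holomorphic_on_subset[OF \<Phi>_holo KI])
  moreover have "\<Phi> ` K \<inter> cball 0 r0 = {}"
    using KI \<Phi>_in by (force simp: outer_disc_def)
  ultimately obtain d where d: "d > 0" "\<And>x y. x \<in> \<Phi> ` K \<Longrightarrow> y \<in> cball 0 r0 \<Longrightarrow> d \<le> dist x y"
    using separate_compact_closed[OF _ closed_cball, of "\<Phi> ` K" 0 r0] by meson
  show ?thesis
  proof (rule that[of "min d 1"])
    fix \<zeta> :: complex assume z: "r0 < norm \<zeta>" "norm \<zeta> < r0 + min d 1"
    then have zE: "\<zeta> \<in> E" by (simp add: outer_disc_def)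
    show "norm (V (G \<zeta>)) < e"
    proof (rule ccontr)
      assume "\<not> norm (V (G \<zeta>)) < e"
      then have "G \<zeta> \<in> K"
        using z M(2)[OF zE] G_in[OF zE] interior_subset[of \<Omega>] unfolding K_def by auto
      then have "\<zeta> \<in> \<Phi> ` K" using \<Phi>_G[OF zE] by (metis image_eqI)
      \<comment> \<open>the nearest point of the inner circle\<close>
      moreover have "of_real (r0 / norm \<zeta>) * \<zeta> \<in> cball 0 r0" using z r0 by (simp add: norm_mult norm_divide)
      ultimately have "d \<le> dist \<zeta> (of_real (r0 / norm \<zeta>) * \<zeta>)" by (rule d(2))
      also have "\<dots> = norm (of_real (1 - r0 / norm \<zeta>) * \<zeta>)" by (simp add: dist_norm algebra_simps)
      also have "\<dots> = \<bar>1 - r0 / norm \<zeta>\<bar> * norm \<zeta>" by (simp only: norm_mult norm_of_real)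
      also have "\<dots> = norm \<zeta> - r0"
      proof -
        have "0 \<le> 1 - r0 / norm \<zeta>" using z r0 by (simp add: divide_le_eq)
        moreover have "norm \<zeta> \<noteq> 0" using z r0 by linarith
        ultimately show ?thesis by (simp add: left_diff_distrib)
      qed
      finally show False using z by simp
    qed
  qed (use d in auto)
qed
end

section \<open>Fields without slip on the boundary\<close>

locale no_slip_field = exterior_map +
  fixes V :: "complex \<Rightarrow> complex" and vinf :: complex
  assumes velocity: "velocity_field_on \<Omega> V" and div_free: "divergence_free_on \<Omega> V"
    and no_slip: "no_slip \<Omega> V" and V_infinity: "(V \<longlongrightarrow> vinf) at_infinity"
    and circulation_limit: "(circulation V \<longlongrightarrow> 0) at_top"
    and vorticity_integrable: "vorticity \<Omega> \<Phi> V absolutely_integrable_on outer_disc r0"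
begin

abbreviation "w \<equiv> vorticity \<Omega> \<Phi> V"

text \<open>
  The differential of \<open>V\<close> in terms of the partial derivatives in which the vorticity is expressed.
\<close>

definition DV :: "complex \<Rightarrow> complex \<Rightarrow> complex" where
  "DV z h = of_real (Re h) * partial1 V z + of_real (Im h) * partial2 V z"

lemma continuous_V: "continuous_on \<Omega> V"
  using velocity by (simp add: velocity_field_on_def)

lemma continuous_partials: "continuous_on (interior \<Omega>) (partial1 V)" "continuous_on (interior \<Omega>) (partial2 V)"
  using velocity by (auto simp: velocity_field_on_def)

lemma C1_V: "real_C1_on (interior \<Omega>) V DV"
  unfolding real_C1_on_def
proof (intro conjI ballI allI)
  fix z assume z: "z \<in> interior \<Omega>"
  have "V differentiable (at z)"
    using velocity z unfolding velocity_field_on_def differentiable_on_def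
    by (metis at_within_interior interior_interior)
  then obtain F where F: "(V has_derivative F) (at z)" by (auto simp: differentiable_def)
  have lin: "linear F" using F has_derivative_linear by blast
  have l1: "((\<lambda>s. Complex s (Im z)) has_derivative (\<lambda>h. h *\<^sub>R 1)) (at (Re z))"
    unfolding Complex_eq by (auto intro!: derivative_eq_intros simp: scaleR_conv_of_real)
  have l2: "((\<lambda>s. Complex (Re z) s) has_derivative (\<lambda>h. h *\<^sub>R \<i>)) (at (Im z))"
    unfolding Complex_eq by (auto intro!: derivative_eq_intros simp: scaleR_conv_of_real)
  have "((\<lambda>s. V (Complex s (Im z))) has_vector_derivative F 1) (at (Re z))"
    using has_derivative_compose[OF l1, of V F] F
    by (simp only: has_vector_derivative_def linear_scale[OF lin] complex_surj)
  then have p1: "partial1 V z = F 1" unfolding partial1_def by (rule vector_derivative_at)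
  have "((\<lambda>s. V (Complex (Re z) s)) has_vector_derivative F \<i>) (at (Im z))"
    using has_derivative_compose[OF l2, of V F] F
    by (simp only: has_vector_derivative_def linear_scale[OF lin] complex_surj)
  then have p2: "partial2 V z = F \<i>" unfolding partial2_def by (rule vector_derivative_at)
  have "F = DV z"
    unfolding DV_def p1 p2 by (rule ext) (rule real_linear_complex[OF lin])
  then show "(V has_derivative DV z) (at z)" using F by simp
next
  show "continuous_on (interior \<Omega>) (\<lambda>z. DV z h)" for h
    unfolding DV_def by (intro continuous_intros continuous_partials)
qed simp

lemma dbar_cnj_DV: "z \<in> interior \<Omega> \<Longrightarrow> dbar (\<lambda>h. cnj (DV z h)) = of_real (curl V z)"
  using div_free
  by (simp add: divergence_free_on_def divergence_def curl_def dbar_def DV_def complex_eq_iff)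

lemma linear_cnj_DV: "z \<in> interior \<Omega> \<Longrightarrow> linear (\<lambda>h. cnj (DV z h))"
  using real_C1_on_linear[OF real_C1_on_cnj[OF C1_V]] .

lemma continuous_curl: "continuous_on (interior \<Omega>) (curl V)"
  unfolding curl_def by (intro continuous_intros continuous_partials)

lemma V_G_vanishing:
  assumes "e > 0"
  shows "\<exists>d>0. \<forall>\<zeta>. r0 < norm \<zeta> \<longrightarrow> norm \<zeta> < r0 + d \<longrightarrow> norm (V (G \<zeta>)) < e"
  using vanishing_at_inner_circle[OF continuous_V no_slip assms] by metis

lemma V_G_infinity: "((\<lambda>\<zeta>. V (G \<zeta>)) \<longlongrightarrow> vinf) at_infinity"
  using filterlim_compose[OF V_infinity G_at_infinity] .

lemma V_G_bounded_far: obtains B R where "B > 0" "\<And>\<zeta>. norm \<zeta> \<ge> R \<Longrightarrow> norm (V (G \<zeta>)) \<le> B"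
proof -
  have "\<forall>\<^sub>F \<zeta> in at_infinity. dist (V (G \<zeta>)) vinf < 1"
    using V_G_infinity by (rule tendstoD) simp
  then obtain R where "\<And>\<zeta>. norm \<zeta> \<ge> R \<Longrightarrow> dist (V (G \<zeta>)) vinf < 1" by (auto simp: eventually_at_infinity)
  then have "norm (V (G \<zeta>)) \<le> norm vinf + 1" if "norm \<zeta> \<ge> R" for \<zeta>
    using that norm_triangle_ineq2[of "V (G \<zeta>)" vinf] by (fastforce simp: dist_norm)
  then show ?thesis using that[of "norm vinf + 1" R] by (simp add: add_nonneg_pos)
qed

section \<open>Integrability near the boundary and at infinity\<close>

lemma pullback:
  fixes g :: "complex \<Rightarrow> complex"
  assumes "open T" "T \<subseteq> E"
  shows "(\<lambda>\<zeta>. of_real ((norm (deriv G \<zeta>))\<^sup>2) * g (G \<zeta>)) absolutely_integrable_on T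
         \<longleftrightarrow> g absolutely_integrable_on G ` T"
    and "g absolutely_integrable_on G ` T \<Longrightarrow>
          integral T (\<lambda>\<zeta>. of_real ((norm (deriv G \<zeta>))\<^sup>2) * g (G \<zeta>)) = integral (G ` T) g"
proof -
  have "(\<lambda>\<zeta>. of_real ((norm (deriv G \<zeta>))\<^sup>2) * g (G \<zeta>)) absolutely_integrable_on T \<and>
      integral T (\<lambda>\<zeta>. of_real ((norm (deriv G \<zeta>))\<^sup>2) * g (G \<zeta>)) = b
    \<longleftrightarrow> g absolutely_integrable_on G ` T \<and> integral (G ` T) g = b" for b
  proof (rule conformal_change_of_variables)
    show "(G has_field_derivative deriv G z) (at z within T)" if "z \<in> T" for z
      using G_derivative that assms(2) by (meson DERIV_subset subset_UNIV subsetD)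
    show "inj_on G T" using inj_G assms(2) by (rule inj_on_subset)
  qed (use assms in auto)
  then show "(\<lambda>\<zeta>. of_real ((norm (deriv G \<zeta>))\<^sup>2) * g (G \<zeta>)) absolutely_integrable_on T
         \<longleftrightarrow> g absolutely_integrable_on G ` T"
    and "g absolutely_integrable_on G ` T \<Longrightarrow>
          integral T (\<lambda>\<zeta>. of_real ((norm (deriv G \<zeta>))\<^sup>2) * g (G \<zeta>)) = integral (G ` T) g"
    by metis+
qed

definition gradient_size :: "complex \<Rightarrow> real" where
  "gradient_size z = norm (partial1 V z) + norm (partial2 V z)"

lemma abs_curl_le: "\<bar>curl V z\<bar> \<le> gradient_size z"
  using abs_Im_le_cmod[of "partial1 V z"] abs_Re_le_cmod[of "partial2 V z"]
  by (simp add: curl_def gradient_size_def)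

lemma gradient_integrable:
  shows "gradient_size absolutely_integrable_on (interior \<Omega> \<inter> ball 0 R)"
    and "\<lbrakk>open T; T \<subseteq> E; G ` T \<subseteq> ball 0 R\<rbrakk> \<Longrightarrow>
      (\<lambda>\<zeta>. (norm (deriv G \<zeta>))\<^sup>2 * gradient_size (G \<zeta>)) absolutely_integrable_on T"
proof -
  show 1: "gradient_size absolutely_integrable_on (interior \<Omega> \<inter> ball 0 R)"
    unfolding gradient_size_def
    by (intro set_integral_add absolutely_integrable_norm[unfolded o_def])
       (use velocity in \<open>auto simp: velocity_field_on_def\<close>)
  assume T: "open T" "T \<subseteq> E" "G ` T \<subseteq> ball 0 R"
  have "open (G ` T)"
    by (rule open_mapping_thm3[OF holomorphic_on_subset[OF G_holo T(2)] T(1) inj_on_subset[OF inj_G T(2)]])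
  moreover have "G ` T \<subseteq> interior \<Omega> \<inter> ball 0 R" using T G_in by auto
  ultimately have "gradient_size absolutely_integrable_on G ` T"
    by (intro set_integrable_subset[OF 1]) auto
  then have "(\<lambda>z. of_real (gradient_size z) :: complex) absolutely_integrable_on G ` T"
    using absolutely_integrable_linear[OF _ bounded_linear_of_real] by (auto simp: o_def)
  then have "(\<lambda>\<zeta>. of_real ((norm (deriv G \<zeta>))\<^sup>2) * (of_real (gradient_size (G \<zeta>)) :: complex)) absolutely_integrable_on T"
    by (subst pullback(1)[OF T(1,2)])
  then have "(\<lambda>\<zeta>. Re (of_real ((norm (deriv G \<zeta>))\<^sup>2) * (of_real (gradient_size (G \<zeta>)) :: complex))) absolutely_integrable_on T"
    by (rule absolutely_integrable_linear[OF _ bounded_linear_Re, unfolded o_def])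
  then show "(\<lambda>\<zeta>. (norm (deriv G \<zeta>))\<^sup>2 * gradient_size (G \<zeta>)) absolutely_integrable_on T"
    by (simp only: of_real_mult[symmetric] Re_complex_of_real)
qed

lemma G_annulus_bounded: obtains R where "G ` annulus r0 r \<subseteq> ball 0 R"
proof -
  obtain M where M: "\<And>\<zeta>. \<zeta> \<in> E \<Longrightarrow> norm (G \<zeta>) \<le> max M (norm \<zeta> + 1)"
    using inverse_near_infinity by metis
  have "norm (G \<zeta>) < max M (r + 1) + 1" if "\<zeta> \<in> annulus r0 r" for \<zeta>
    using M[of \<zeta>] that by (auto simp: annulus_def outer_disc_def max_def split: if_splits)
  then show ?thesis by (intro that[of "max M (r + 1) + 1"]) auto
qed

lemma annulus_subset_E: "annulus r0 r \<subseteq> E" by (auto simp: annulus_def outer_disc_def)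

lemma continuous_w: "continuous_on E w"
  unfolding vorticity_def
  by (rule continuous_on_compose2[OF continuous_curl continuous_on_G(1)]) (use G_in in auto)

text \<open>
  Near a corner of the boundary \<open>G'\<close> may be unbounded, and integrability of \<open>w\<close> alone says nothing
  about \<open>G' w\<close>. But \<open>|G'| \<le> 1 + |G'|\<^sup>2\<close>, and \<open>|G'|\<^sup>2 |w|\<close> is the pullback of \<open>|curl V|\<close>, which is
  integrable on bounded parts of \<open>\<Omega>\<close>. Far out \<open>G'\<close> is bounded.
\<close>

lemma vorticity_majorant:
  "\<exists>h. h integrable_on E \<and> (\<forall>\<zeta>\<in>E. norm (deriv G \<zeta>) * \<bar>w \<zeta>\<bar> \<le> h \<zeta>)
      \<and> (\<forall>\<zeta>\<in>E. (norm (deriv G \<zeta>))\<^sup>2 * \<bar>w \<zeta>\<bar> \<le> h \<zeta>)"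
proof -
  obtain M where M: "r0 < M" "\<And>\<zeta>. norm \<zeta> \<ge> M \<Longrightarrow> norm (deriv G \<zeta>) \<le> 2"
    using inverse_near_infinity by metis
  obtain R where R: "G ` annulus r0 M \<subseteq> ball 0 R" using G_annulus_bounded by blast
  define g where "g = (\<lambda>\<zeta>. (norm (deriv G \<zeta>))\<^sup>2 * gradient_size (G \<zeta>))"
  define h where "h = (\<lambda>\<zeta>. 4 * \<bar>w \<zeta>\<bar> + (if \<zeta> \<in> annulus r0 M then g \<zeta> else 0))"
  have "g integrable_on annulus r0 M"
    unfolding g_def
    by (rule set_lebesgue_integral_eq_integral(1)[OF gradient_integrable(2)[OF open_annulus annulus_subset_E R]])
  then have "(\<lambda>\<zeta>. if \<zeta> \<in> annulus r0 M then g \<zeta> else 0) integrable_on E"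
    using annulus_subset_E[of M] by (simp add: integrable_restrict_Int Int_absorb1 Int_absorb2)
  moreover have "(\<lambda>\<zeta>. \<bar>w \<zeta>\<bar>) integrable_on E"
    using vorticity_integrable by (simp add: absolutely_integrable_on_def)
  ultimately have "h integrable_on E"
    unfolding h_def by (intro integrable_add integrable_on_mult_right)
  moreover have "norm (deriv G \<zeta>) * \<bar>w \<zeta>\<bar> \<le> h \<zeta> \<and> (norm (deriv G \<zeta>))\<^sup>2 * \<bar>w \<zeta>\<bar> \<le> h \<zeta>" if "\<zeta> \<in> E" for \<zeta>
  proof (cases "norm \<zeta> < M")
    case True
    let ?d = "norm (deriv G \<zeta>)"
    have "\<zeta> \<in> annulus r0 M" using that True by (simp add: annulus_def outer_disc_def)
    then have h: "h \<zeta> = 4 * \<bar>w \<zeta>\<bar> + g \<zeta>" by (simp add: h_def)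
    have 1: "?d\<^sup>2 * \<bar>w \<zeta>\<bar> \<le> g \<zeta>"
      unfolding g_def vorticity_def by (intro mult_left_mono abs_curl_le) auto
    have "2 * ?d \<le> ?d\<^sup>2 + 1" using zero_le_power2[of "?d - 1"] by (simp add: power2_diff)
    then have "?d \<le> 1 + ?d\<^sup>2" using norm_ge_zero[of "deriv G \<zeta>"] by linarith
    then have "?d * \<bar>w \<zeta>\<bar> \<le> (1 + ?d\<^sup>2) * \<bar>w \<zeta>\<bar>" by (intro mult_right_mono) auto
    then show ?thesis
      using 1 abs_ge_zero[of "w \<zeta>"] mult_nonneg_nonneg[OF zero_le_power2 abs_ge_zero, of ?d "w \<zeta>"]
      unfolding h distrib_right by linarith
  next
    case False
    let ?d = "norm (deriv G \<zeta>)"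
    have d: "?d \<le> 2" using M(2) False by simp
    then have "?d\<^sup>2 \<le> 2\<^sup>2" by (intro power_mono) auto
    then have "?d\<^sup>2 * \<bar>w \<zeta>\<bar> \<le> 4 * \<bar>w \<zeta>\<bar>" "?d * \<bar>w \<zeta>\<bar> \<le> 4 * \<bar>w \<zeta>\<bar>"
      using d by (auto intro!: mult_right_mono)
    then show ?thesis using False by (simp add: h_def annulus_def)
  qed
  ultimately show ?thesis by blast
qed

section \<open>Moments as limits of circle integrals\<close>

abbreviation moment_integrand :: "nat \<Rightarrow> complex \<Rightarrow> complex" where
  "moment_integrand k \<zeta> \<equiv> cnj (deriv G \<zeta>) * (of_real (w \<zeta>) / \<zeta> ^ k)"

lemma moment_integrable: "moment_integrand k absolutely_integrable_on E"
proof -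
  obtain h where h: "h integrable_on E" "\<And>\<zeta>. \<zeta> \<in> E \<Longrightarrow> norm (deriv G \<zeta>) * \<bar>w \<zeta>\<bar> \<le> h \<zeta>"
    using vorticity_majorant by blast
  show ?thesis
  proof (rule measurable_bounded_by_integrable_imp_absolutely_integrable)
    show "moment_integrand k \<in> borel_measurable (lebesgue_on E)"
      by (intro continuous_imp_measurable_on_sets_lebesgue continuous_intros continuous_w continuous_on_G)
         (use open_E nonzero_E in auto)
    show "(\<lambda>\<zeta>. h \<zeta> * (1 / r0 ^ k)) integrable_on E" by (rule integrable_on_mult_left[OF h(1)])
    show "norm (moment_integrand k \<zeta>) \<le> h \<zeta> * (1 / r0 ^ k)" if "\<zeta> \<in> E" for \<zeta>
    proof -
      have "norm (moment_integrand k \<zeta>) = (norm (deriv G \<zeta>) * \<bar>w \<zeta>\<bar>) * (1 / norm \<zeta> ^ k)"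
        by (simp add: norm_mult norm_divide norm_power)
      also have "\<dots> \<le> h \<zeta> * (1 / r0 ^ k)"
      proof (rule mult_mono[OF h(2)[OF that]])
        show "1 / norm \<zeta> ^ k \<le> 1 / r0 ^ k"
          using that r0 by (intro divide_left_mono power_mono mult_pos_pos zero_less_power) (auto simp: outer_disc_def)
        show "0 \<le> h \<zeta>" using h(2)[OF that] by (meson abs_ge_zero mult_nonneg_nonneg norm_ge_zero order_trans)
      qed auto
      finally show ?thesis .
    qed
  qed (use open_E in auto)
qed

text \<open>
  The moment integrand is \<open>dbar\<close> of \<open>cnj (V \<circ> G) / \<zeta>^k\<close>, and this function tends to \<open>0\<close> at the inner
  circle.
\<close>

lemma moment_annulus:
  assumes "r > r0"
  shows "integral (annulus r0 r) (moment_integrand k) = circle_integral (\<lambda>\<zeta>. cnj (V (G \<zeta>)) * (1 / \<zeta> ^ k)) r"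
proof -
  let ?Y = "\<lambda>\<zeta>. cnj (V (G \<zeta>)) * (1 / \<zeta> ^ k)"
  let ?D = "\<lambda>\<zeta> h. cnj (DV (G \<zeta>) (deriv G \<zeta> * h)) * (1 / \<zeta> ^ k) + cnj (V (G \<zeta>)) * (deriv (\<lambda>\<zeta>. 1 / \<zeta> ^ k) \<zeta> * h)"
  have C: "real_C1_on E ?Y ?D"
    by (intro real_C1_on_times_holomorphic real_C1_on_compose_holomorphic[OF real_C1_on_cnj[OF C1_V]] G_holo open_E holomorphic_intros)
       (use G_in nonzero_E in auto)
  have dbar: "dbar (?D \<zeta>) = moment_integrand k \<zeta>" if "\<zeta> \<in> E" for \<zeta>
    unfolding dbar_times_holomorphic dbar_compose_holomorphic[OF linear_cnj_DV[OF G_in[OF that]]] dbar_cnj_DV[OF G_in[OF that]]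
    by (simp add: vorticity_def)
  have int: "(\<lambda>\<zeta>. dbar (?D \<zeta>)) absolutely_integrable_on annulus r0 r"
  proof -
    have "moment_integrand k absolutely_integrable_on annulus r0 r"
      by (rule set_integrable_subset[OF moment_integrable]) (use annulus_subset_E open_annulus in auto)
    then show ?thesis
      by (rule set_integrable_cong[THEN iffD1, rotated -1]) (simp_all only: dbar[OF subsetD[OF annulus_subset_E]])
  qed
  have "integral (annulus r0 r) (\<lambda>\<zeta>. dbar (?D \<zeta>)) = circle_integral ?Y r"
  proof (rule Green_annulus_vanishing_inner[OF C _ assms _ int])
    show "(circle_integral ?Y \<longlongrightarrow> 0) (at_right r0)"
    proof (rule tendstoI)
      fix e :: real assume e: "e > 0"
      define c where "c = 2 * pi * (r0 + 1) * (1 / r0 ^ k)"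
      have c: "c > 0" using r0 by (simp add: c_def)
      obtain d where d: "d > 0" "\<And>\<zeta>. r0 < norm \<zeta> \<Longrightarrow> norm \<zeta> < r0 + d \<Longrightarrow> norm (V (G \<zeta>)) < e / (2 * c)"
        using V_G_vanishing[of "e / (2 * c)"] e c by auto
      have "dist (circle_integral ?Y s) 0 < e" if s: "r0 < s" "s < r0 + min d 1" for s
      proof -
        have sk: "1 / s ^ k \<le> 1 / r0 ^ k"
          using s r0 by (intro divide_left_mono power_mono mult_pos_pos zero_less_power) auto
        have "norm (circle_integral ?Y s) \<le> 2 * pi * s * (e / (2 * c) * (1 / r0 ^ k))"
        proof (rule norm_circle_integral_le)
          show "norm (?Y z) \<le> e / (2 * c) * (1 / r0 ^ k)" if "norm z = s" for z
            unfolding norm_mult complex_mod_cnj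
          proof (rule mult_mono)
            show "norm (V (G z)) \<le> e / (2 * c)" using d(2)[of z] that s by linarith
            show "norm (1 / z ^ k) \<le> 1 / r0 ^ k" using sk that by (simp add: norm_divide norm_power)
          qed (use e c in auto)
        qed (use s r0 e c in auto)
        also have "\<dots> \<le> 2 * pi * (r0 + 1) * (e / (2 * c) * (1 / r0 ^ k))"
          using s r0 e c by (intro mult_right_mono mult_left_mono) auto
        also have "\<dots> = c * (e / (2 * c))" by (simp add: c_def)
        also have "\<dots> < e" using c e by simp
        finally show ?thesis by simp
      qed
      then show "\<forall>\<^sub>F s in at_right r0. dist (circle_integral ?Y s) 0 < e"
        unfolding eventually_at_right_field using d(1) by (intro exI[of _ "r0 + min d 1"]) auto
    qed
  qed (use r0 in \<open>auto simp: outer_disc_def\<close>)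
  moreover have "integral (annulus r0 r) (\<lambda>\<zeta>. dbar (?D \<zeta>)) = integral (annulus r0 r) (moment_integrand k)"
    using dbar annulus_subset_E by (intro integral_cong) auto
  ultimately show ?thesis by simp
qed

lemma moment_as_limit:
  "((\<lambda>r. circle_integral (\<lambda>\<zeta>. cnj (V (G \<zeta>)) * (1 / \<zeta> ^ k)) r) \<longlongrightarrow> integral E (moment_integrand k)) at_top"
  using integral_annulus_tendsto_outer[OF moment_integrable[of k]]
  by (rule Lim_transform_eventually)
     (use eventually_gt_at_top[of r0] in eventually_elim, simp only: moment_annulus)

lemma first_moment: "integral E (moment_integrand 1) = 2 * of_real pi * \<i> * cnj vinf"
proof (rule tendsto_unique[OF _ moment_as_limit])
  show "(circle_integral (\<lambda>\<zeta>. cnj (V (G \<zeta>)) * (1 / \<zeta> ^ 1)) \<longlongrightarrow> 2 * of_real pi * \<i> * cnj vinf) at_top"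
  proof (rule tendstoI)
    fix e :: real assume e: "e > 0"
    have "\<forall>\<^sub>F \<zeta> in at_infinity. dist (V (G \<zeta>)) vinf < e / (4 * pi)"
      using V_G_infinity by (rule tendstoD) (use e in simp)
    then obtain R where R: "\<And>\<zeta>. norm \<zeta> \<ge> R \<Longrightarrow> dist (V (G \<zeta>)) vinf < e / (4 * pi)"
      by (auto simp: eventually_at_infinity)
    have "dist (circle_integral (\<lambda>\<zeta>. cnj (V (G \<zeta>)) * (1 / \<zeta> ^ 1)) r) (2 * of_real pi * \<i> * cnj vinf) < e"
      if r: "r > max R r0" for r
    proof -
      have rp: "r > 0" using r r0 by simp
      have "circle_integral (\<lambda>\<zeta>. cnj vinf * (1 / \<zeta>)) r = integral {0..2*pi} (\<lambda>\<theta>. cnj vinf * \<i>)"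
        unfolding circle_integral_def using rp by (intro integral_cong) (simp add: field_simps)
      also have "\<dots> = 2 * of_real pi * \<i> * cnj vinf" by (simp add: scaleR_conv_of_real mult_ac)
      finally have c: "circle_integral (\<lambda>\<zeta>. cnj vinf * (1 / \<zeta>)) r = 2 * of_real pi * \<i> * cnj vinf" .
      have sE: "sphere 0 r \<subseteq> E" using r by (auto simp: outer_disc_def)
      have "continuous_on E (\<lambda>\<zeta>. V (G \<zeta>))"
        by (rule continuous_on_compose2[OF real_C1_on_continuous[OF C1_V] continuous_on_G(1)]) (use G_in in auto)
      then have "continuous_on (sphere 0 r) (\<lambda>\<zeta>. V (G \<zeta>))" using sE continuous_on_subset by blast
      then have "circle_integral (\<lambda>\<zeta>. cnj (V (G \<zeta>)) * (1 / \<zeta>)) r - circle_integral (\<lambda>\<zeta>. cnj vinf * (1 / \<zeta>)) r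
        = circle_integral (\<lambda>\<zeta>. cnj (V (G \<zeta>)) * (1 / \<zeta>) - cnj vinf * (1 / \<zeta>)) r"
        using rp by (intro circle_integral_diff continuous_intros) auto
      also have "norm \<dots> \<le> 2 * pi * r * (e / (4 * pi) * (1 / r))"
      proof (rule norm_circle_integral_le)
        fix z :: complex assume z: "norm z = r"
        have "norm (cnj (V (G z)) * (1 / z) - cnj vinf * (1 / z)) = norm (cnj (V (G z) - vinf)) * (1 / r)"
          unfolding left_diff_distrib[symmetric] norm_mult using z by (simp add: norm_divide)
        also have "\<dots> \<le> e / (4 * pi) * (1 / r)"
          using R[of z] z r rp by (intro mult_right_mono) (auto simp: dist_norm simp del: complex_cnj_diff)
        finally show "norm (cnj (V (G z)) * (1 / z) - cnj vinf * (1 / z)) \<le> e / (4 * pi) * (1 / r)" .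
      qed (use rp e in auto)
      also have "\<dots> < e" using rp e by simp
      finally show ?thesis using c by (simp add: dist_norm)
    qed
    then show "\<forall>\<^sub>F r in at_top. dist (circle_integral (\<lambda>\<zeta>. cnj (V (G \<zeta>)) * (1 / \<zeta> ^ 1)) r) (2 * of_real pi * \<i> * cnj vinf) < e"
      using eventually_gt_at_top[of "max R r0"] by (rule eventually_mono[rotated]) blast
  qed
qed simp

lemma higher_moments:
  assumes "k \<ge> 2" shows "integral E (moment_integrand k) = 0"
proof (rule tendsto_unique[OF _ moment_as_limit])
  obtain B R where B: "B > 0" "\<And>\<zeta>. norm \<zeta> \<ge> R \<Longrightarrow> norm (V (G \<zeta>)) \<le> B"
    using V_G_bounded_far by metis
  show "(circle_integral (\<lambda>\<zeta>. cnj (V (G \<zeta>)) * (1 / \<zeta> ^ k)) \<longlongrightarrow> 0) at_top"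
  proof (rule Lim_null_comparison)
    show "((\<lambda>r. (2 * pi * B) / r) \<longlongrightarrow> 0) at_top"
      by (rule real_tendsto_divide_at_top[OF tendsto_const filterlim_ident])
    show "\<forall>\<^sub>F r in at_top. norm (circle_integral (\<lambda>\<zeta>. cnj (V (G \<zeta>)) * (1 / \<zeta> ^ k)) r) \<le> (2 * pi * B) / r"
      using eventually_gt_at_top[of "max R 1"]
    proof eventually_elim
      fix r assume r: "max R 1 < r"
      have rk: "1 / r ^ k \<le> 1 / r\<^sup>2"
        using r assms by (intro divide_left_mono power_increasing mult_pos_pos zero_less_power) auto
      have "norm (circle_integral (\<lambda>\<zeta>. cnj (V (G \<zeta>)) * (1 / \<zeta> ^ k)) r) \<le> 2 * pi * r * (B * (1 / r ^ 2))"
      proof (rule norm_circle_integral_le)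
        show "norm (cnj (V (G z)) * (1 / z ^ k)) \<le> B * (1 / r ^ 2)" if "norm z = r" for z
          unfolding norm_mult complex_mod_cnj using B(2)[of z] that r B(1) rk
          by (intro mult_mono) (auto simp: norm_divide norm_power)
      qed (use r B in auto)
      also have "\<dots> = (2 * pi * B) / r" using r by (simp add: power2_eq_square)
      finally show "norm (circle_integral (\<lambda>\<zeta>. cnj (V (G \<zeta>)) * (1 / \<zeta> ^ k)) r) \<le> (2 * pi * B) / r" .
    qed
  qed
qed simp

end

section \<open>The total vorticity\<close>

context no_slip_field begin

lemma linear_truncate': "linear (truncate' n u)"
  using real_C1_on_linear[OF real_C1_on_truncate] by blast

text \<open>
  The differential of \<open>cnj (truncate n \<circ> V)\<close>.
\<close>

definition trunc_deriv :: "nat \<Rightarrow> complex \<Rightarrow> complex \<Rightarrow> complex" where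
  "trunc_deriv n z h = cnj (truncate' (real n) (V z) (DV z h))"

lemma linear_trunc_deriv: "z \<in> interior \<Omega> \<Longrightarrow> linear (trunc_deriv n z)"
  unfolding trunc_deriv_def
  using linear_compose[OF linear_compose[OF real_C1_on_linear[OF C1_V] linear_truncate'] bounded_linear.linear[OF bounded_linear_cnj]]
  by (simp add: o_def)

lemma C1_truncated: "real_C1_on (interior \<Omega>) (\<lambda>z. cnj (truncate (real n) (V z))) (trunc_deriv n)"
  unfolding trunc_deriv_def
proof (rule real_C1_on_cnj, unfold real_C1_on_def, intro conjI ballI allI)
  fix z assume "z \<in> interior \<Omega>"
  then have "(V has_derivative DV z) (at z)" using C1_V by (auto simp: real_C1_on_def)
  moreover have "(truncate n has_derivative truncate' n (V z)) (at (V z))"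
    using real_C1_on_truncate by (auto simp: real_C1_on_def)
  ultimately show "((\<lambda>z. truncate n (V z)) has_derivative (\<lambda>h. truncate' n (V z) (DV z h))) (at z)"
    by (rule has_derivative_compose)
next
  show "continuous_on (interior \<Omega>) (\<lambda>z. truncate' n (V z) (DV z h))" for h
    using C1_V by (intro real_C1_on_continuous_apply[OF real_C1_on_truncate] real_C1_on_continuous[OF C1_V])
       (auto simp: real_C1_on_def)
qed simp

lemma norm_dbar_trunc_le: "norm (dbar (trunc_deriv n z)) \<le> 5 * gradient_size z"
proof -
  have "norm (dbar (trunc_deriv n z)) \<le> norm (trunc_deriv n z 1) + norm (trunc_deriv n z \<i>)"
    unfolding dbar_def by (rule order_trans[OF norm_triangle_ineq4]) (simp add: norm_mult)
  also have "\<dots> \<le> 5 * norm (DV z 1) + 5 * norm (DV z \<i>)"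
    unfolding trunc_deriv_def complex_mod_cnj by (intro add_mono norm_truncate'_le) auto
  finally show ?thesis by (simp add: DV_def gradient_size_def)
qed

lemma dbar_trunc_limit:
  assumes "z \<in> interior \<Omega>"
  shows "(\<lambda>n. dbar (trunc_deriv n z)) \<longlonglongrightarrow> (if V z = 0 then 0 else of_real (curl V z))"
proof -
  have "(\<lambda>n. dbar (trunc_deriv n z)) \<longlonglongrightarrow>
      \<i> * cnj (if V z = 0 then 0 else DV z 1) - cnj (if V z = 0 then 0 else DV z \<i>)"
    unfolding dbar_def trunc_deriv_def by (intro tendsto_intros tendsto_cnj truncate_limits)
  moreover have "\<i> * cnj (if V z = 0 then 0 else DV z 1) - cnj (if V z = 0 then 0 else DV z \<i>)
      = (if V z = 0 then 0 else of_real (curl V z))"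
    using dbar_cnj_DV[OF assms] by (simp add: dbar_def)
  ultimately show ?thesis by simp
qed

definition moving :: "complex set" where "moving = {z \<in> interior \<Omega>. V z \<noteq> 0}"

lemma open_moving: "open moving"
proof -
  have "open (interior \<Omega> \<inter> V -` (- {0}))"
    by (rule continuous_open_preimage[OF real_C1_on_continuous[OF C1_V]]) auto
  then show ?thesis by (simp add: moving_def vimage_def Int_def)
qed

lemma circle_integral_truncate_tendsto:
  assumes Y: "continuous_on (sphere 0 r) Y" "continuous_on (sphere 0 r) c" and r: "r \<ge> 0"
  shows "(\<lambda>n. circle_integral (\<lambda>z. cnj (truncate (real n) (Y z)) * c z) r) \<longlonglongrightarrow> circle_integral (\<lambda>z. cnj (Y z) * c z) r"
  unfolding circle_integral_def
proof (rule dominated_convergence(2))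
  have t: "continuous_on (sphere 0 r) (\<lambda>z. truncate n (Y z))" for n
    by (rule continuous_on_compose2[OF real_C1_on_continuous[OF real_C1_on_truncate] Y(1)]) auto
  show "(\<lambda>\<theta>. cnj (truncate (real n) (Y (of_real r * cis \<theta>))) * c (of_real r * cis \<theta>) * (\<i> * of_real r * cis \<theta>)) integrable_on {0..2*pi}" for n
    by (rule circle_integrable[where Y = "\<lambda>z. cnj (truncate (real n) (Y z)) * c z"]) (intro continuous_intros t Y r)+
  show "(\<lambda>\<theta>. norm (Y (of_real r * cis \<theta>)) * norm (c (of_real r * cis \<theta>)) * r) integrable_on {0..2*pi}"
    by (intro integrable_continuous_interval continuous_intros continuous_on_compose2[OF Y(1)] continuous_on_compose2[OF Y(2)])
       (use r in \<open>auto simp: norm_mult intro!: continuous_intros\<close>)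
  show "norm (cnj (truncate (real n) (Y (of_real r * cis \<theta>))) * c (of_real r * cis \<theta>) * (\<i> * of_real r * cis \<theta>))
      \<le> norm (Y (of_real r * cis \<theta>)) * norm (c (of_real r * cis \<theta>)) * r" for n \<theta>
    using r by (simp add: norm_mult norm_truncate_le mult_right_mono)
  show "(\<lambda>n. cnj (truncate (real n) (Y (of_real r * cis \<theta>))) * c (of_real r * cis \<theta>) * (\<i> * of_real r * cis \<theta>))
      \<longlonglongrightarrow> cnj (Y (of_real r * cis \<theta>)) * c (of_real r * cis \<theta>) * (\<i> * of_real r * cis \<theta>)" for \<theta>
    by (intro tendsto_intros tendsto_cnj truncate_limits)
qed

text \<open>
  The truncated field, extended by \<open>0\<close> across the boundary, is \<open>C\<^sup>1\<close> on the whole plane, since it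
  vanishes in a neighbourhood of every point outside the interior of \<open>\<Omega>\<close>. So Green's formula holds
  for it on the full disc, and its \<open>dbar\<close> converges to \<open>curl V\<close> where \<open>V \<noteq> 0\<close> and to \<open>0\<close> elsewhere.
\<close>

lemma circle_integral_physical:
  assumes \<rho>: "\<rho> > 0" and out: "sphere 0 \<rho> \<subseteq> \<Omega>"
  shows "circle_integral (\<lambda>z. cnj (V z)) \<rho> = integral (moving \<inter> ball 0 \<rho>) (\<lambda>z. of_real (curl V z))"
proof -
  define X where "X = (\<lambda>z. if z \<in> \<Omega> then V z else 0)"
  define Y where "Y = (\<lambda>(n::nat) z. cnj (truncate (real n) (X z)))"
  define D where "D = (\<lambda>n z h. if z \<in> interior \<Omega> then trunc_deriv n z h else 0)"
  have front: "V z = 0" if "z \<in> frontier \<Omega>" for z using no_slip that by (simp add: no_slip_def)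
  have contX: "continuous_on UNIV X"
  proof -
    have "continuous_on (\<Omega> \<union> closure (- \<Omega>)) (\<lambda>z. if z \<in> \<Omega> then V z else 0)"
      by (rule continuous_on_cases[OF closed closed_closure continuous_V])
         (use front closed in \<open>auto simp: frontier_def closure_complement\<close>)
    moreover have "\<Omega> \<union> closure (- \<Omega>) = UNIV" using closure_subset by blast
    ultimately show ?thesis by (simp add: X_def)
  qed
  have near: "\<exists>U. open U \<and> z \<in> U \<and> (\<forall>u\<in>U. Y n u = 0 \<and> (\<forall>h. D n u h = 0))" if z: "z \<notin> interior \<Omega>" for n z
  proof (intro exI conjI ballI allI)
    let ?U = "{u. real n * (norm (X u))\<^sup>2 < 1}"
    show "open ?U" by (intro open_Collect_less continuous_intros contX)
    have "X z = 0" using front[of z] z closure_subset[of \<Omega>] by (auto simp: X_def frontier_def)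
    then show "z \<in> ?U" by simp
    fix u h assume u: "u \<in> ?U"
    then show "Y n u = 0" unfolding Y_def by (simp add: truncate_near_0)
    show "D n u h = 0"
    proof (cases "u \<in> interior \<Omega>")
      case True
      then have "X u = V u" using interior_subset by (auto simp: X_def)
      then show ?thesis using u by (simp add: D_def trunc_deriv_def truncate_near_0)
    qed (simp add: D_def)
  qed
  have C1: "real_C1_on UNIV (Y n) (D n)" for n
    unfolding real_C1_on_def
  proof (intro conjI ballI allI)
    have eqY: "Y n z = cnj (truncate (real n) (V z))" if "z \<in> interior \<Omega>" for z
      using that interior_subset[of \<Omega>] by (auto simp: Y_def X_def)
    show "(Y n has_derivative D n z) (at z)" for z
    proof (cases "z \<in> interior \<Omega>")
      case True
      have "((\<lambda>z. cnj (truncate (real n) (V z))) has_derivative trunc_deriv n z) (at z)"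
        using C1_truncated True by (auto simp: real_C1_on_def)
      then have "(Y n has_derivative trunc_deriv n z) (at z)"
        by (rule has_derivative_transform_within_open[OF _ open_interior True]) (simp add: eqY)
      moreover have "D n z = trunc_deriv n z" using True by (auto simp: D_def)
      ultimately show ?thesis by simp
    next
      case False
      obtain U where U: "open U" "z \<in> U" and U0: "\<forall>u\<in>U. Y n u = 0 \<and> (\<forall>h. D n u h = 0)"
        using near[OF False, of n] by (elim exE conjE)
      have "(Y n has_derivative (\<lambda>h. 0)) (at z)"
        by (rule has_derivative_transform_within_open[OF has_derivative_const[of 0] U]) (simp add: U0)
      moreover have "D n z = (\<lambda>h. 0)" using False by (auto simp: D_def)
      ultimately show ?thesis by simp
    qed
    show "continuous_on UNIV (\<lambda>z. D n z h)" for h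
      unfolding continuous_on_eq_continuous_at[OF open_UNIV]
    proof
      fix z
      show "isCont (\<lambda>z. D n z h) z"
      proof (cases "z \<in> interior \<Omega>")
        case True
        have "continuous_on (interior \<Omega>) (\<lambda>z. trunc_deriv n z h)"
          using C1_truncated[of n] by (simp add: real_C1_on_def)
        then have "isCont (\<lambda>z. trunc_deriv n z h) z"
          using True by (simp add: continuous_on_eq_continuous_at)
        moreover have "\<forall>\<^sub>F u in nhds z. D n u h = trunc_deriv n u h"
          unfolding eventually_nhds using True by (intro exI[of _ "interior \<Omega>"]) (auto simp: D_def)
        ultimately show ?thesis using isCont_cong[of "\<lambda>u. D n u h" "\<lambda>u. trunc_deriv n u h" z] by simp
      next
        case False
        obtain U where U: "open U" "z \<in> U" and U0: "\<forall>u\<in>U. Y n u = 0 \<and> (\<forall>h. D n u h = 0)"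
          using near[OF False, of n] by (elim exE conjE)
        have "\<forall>\<^sub>F u in nhds z. D n u h = 0"
          unfolding eventually_nhds by (intro exI[of _ U]) (simp add: U U0)
        then show ?thesis using isCont_cong[of "\<lambda>u. D n u h" "\<lambda>u. 0" z] by simp
      qed
    qed
  qed simp
  have cD: "continuous_on UNIV (\<lambda>z. dbar (D n z))" for n
    using C1[of n] unfolding real_C1_on_def dbar_def by (intro continuous_intros) auto
  have ball_int: "(\<lambda>z. dbar (D n z)) absolutely_integrable_on T"
    if "open T" "T \<subseteq> cball 0 \<rho>" for n T
  proof -
    let ?Q = "cbox (Complex (-\<rho>) (-\<rho>)) (Complex \<rho> \<rho>)"
    have "(\<lambda>z. dbar (D n z)) absolutely_integrable_on ?Q"
      by (rule absolutely_integrable_continuous) (rule continuous_on_subset[OF cD], simp)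
    moreover have "T \<subseteq> ?Q"
    proof
      fix z assume "z \<in> T"
      then have "norm z \<le> \<rho>" using that(2) by auto
      then show "z \<in> ?Q"
        using abs_Re_le_cmod[of z] abs_Im_le_cmod[of z] by (auto simp: mem_cbox_complex)
    qed
    moreover have "T \<in> sets lebesgue" using that(1) by simp
    ultimately show ?thesis using set_integrable_subset by blast
  qed
  have G: "integral (ball 0 \<rho>) (\<lambda>z. dbar (D n z)) = circle_integral (Y n) \<rho>" for n
  proof -
    have "integral (annulus 0 \<rho>) (\<lambda>z. dbar (D n z)) = circle_integral (Y n) \<rho>"
    proof (rule Green_annulus_vanishing_inner[OF C1 order_refl \<rho>])
      show "(\<lambda>z. dbar (D n z)) absolutely_integrable_on annulus 0 \<rho>"
        by (rule ball_int[OF open_annulus]) (auto simp: annulus_def)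
      have "continuous_on (cball 0 1) (Y n)"
        using real_C1_on_continuous[OF C1] continuous_on_subset by blast
      then have "compact (Y n ` cball 0 1)" by (intro compact_continuous_image) auto
      then obtain B where B: "B > 0" "\<And>z. norm z \<le> 1 \<Longrightarrow> norm (Y n z) \<le> B"
        using compact_imp_bounded bounded_pos by (metis (no_types, lifting) dist_0_norm imageI mem_cball)
      show "(circle_integral (Y n) \<longlongrightarrow> 0) (at_right 0)"
      proof (rule Lim_null_comparison)
        show "((\<lambda>r. 2 * pi * r * B) \<longlongrightarrow> 0) (at_right 0)" by (auto intro!: tendsto_eq_intros)
        show "\<forall>\<^sub>F r in at_right 0. norm (circle_integral (Y n) r) \<le> 2 * pi * r * B"
          unfolding eventually_at_right_field
          by (intro exI[of _ 1] conjI allI impI norm_circle_integral_le) (use B in auto)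
      qed
    qed auto
    moreover have "integral (annulus 0 \<rho>) (\<lambda>z. dbar (D n z)) = integral (ball 0 \<rho>) (\<lambda>z. dbar (D n z))"
      by (rule integral_spike_set; rule negligible_subset[OF negligible_sing[of 0]]) (auto simp: annulus_def)
    ultimately show ?thesis by simp
  qed
  have lim: "(\<lambda>n. integral (ball 0 \<rho>) (\<lambda>z. dbar (D n z))) \<longlonglongrightarrow>
      integral (ball 0 \<rho>) (\<lambda>z. if z \<in> moving then of_real (curl V z) else 0)"
  proof (rule dominated_convergence(2))
    show "(\<lambda>z. dbar (D n z)) integrable_on ball 0 \<rho>" for n
      by (rule set_lebesgue_integral_eq_integral(1)[OF ball_int]) auto
    have "gradient_size integrable_on interior \<Omega> \<inter> ball 0 \<rho>"
      by (rule set_lebesgue_integral_eq_integral(1)[OF gradient_integrable(1)])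
    then have "(\<lambda>z. if z \<in> interior \<Omega> then gradient_size z else 0) integrable_on ball 0 \<rho>"
      by (simp add: integrable_restrict_Int)
    then show "(\<lambda>z. 5 * (if z \<in> interior \<Omega> then gradient_size z else 0)) integrable_on ball 0 \<rho>"
      by (rule integrable_on_mult_right)
    fix z
    show "norm (dbar (D n z)) \<le> 5 * (if z \<in> interior \<Omega> then gradient_size z else 0)" for n
      using norm_dbar_trunc_le[of n z] by (simp add: D_def dbar_def)
    show "(\<lambda>n. dbar (D n z)) \<longlonglongrightarrow> (if z \<in> moving then of_real (curl V z) else 0)"
    proof -
      have "dbar (D n z) = (if z \<in> interior \<Omega> then dbar (trunc_deriv n z) else 0)" for n
        by (simp add: D_def dbar_def)
      then show ?thesis
        by (cases "z \<in> interior \<Omega>") (use dbar_trunc_limit[of z] in \<open>auto simp: moving_def\<close>)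
    qed
  qed
  have restrict: "integral (ball 0 \<rho>) (\<lambda>z. if z \<in> moving then of_real (curl V z) else 0 :: complex)
      = integral (moving \<inter> ball 0 \<rho>) (\<lambda>z. of_real (curl V z))"
    by (simp add: integral_restrict_Int Int_commute)
  have boundary: "(\<lambda>n. circle_integral (Y n) \<rho>) \<longlonglongrightarrow> circle_integral (\<lambda>z. cnj (V z)) \<rho>"
  proof -
    have eqV: "X z = V z" if "norm z = \<rho>" for z using out that by (auto simp: X_def)
    have "(\<lambda>n. circle_integral (\<lambda>z. cnj (truncate (real n) (V z)) * 1) \<rho>) \<longlonglongrightarrow> circle_integral (\<lambda>z. cnj (V z) * 1) \<rho>"
      using \<rho> by (intro circle_integral_truncate_tendsto continuous_on_subset[OF continuous_V out]) auto
    moreover have "circle_integral (Y n) \<rho> = circle_integral (\<lambda>z. cnj (truncate (real n) (V z)) * 1) \<rho>" for n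
      using \<rho> by (intro circle_integral_cong) (auto simp: Y_def eqV)
    ultimately show ?thesis by simp
  qed
  show ?thesis
    using LIMSEQ_unique[OF boundary lim[unfolded G]] unfolding restrict .
qed

definition moving_pullback :: "complex set" where "moving_pullback = {\<zeta> \<in> E. V (G \<zeta>) \<noteq> 0}"

text \<open>
  With the Jacobian included, so that integrals of \<open>pulled_vorticity\<close> are integrals of \<open>curl V\<close> over the image
  under \<open>G\<close>.
\<close>

abbreviation "pulled_vorticity \<zeta> \<equiv> of_real ((norm (deriv G \<zeta>))\<^sup>2) * (of_real (curl V (G \<zeta>)) :: complex)"

lemma continuous_VG: "continuous_on E (\<lambda>\<zeta>. V (G \<zeta>))"
  by (rule continuous_on_compose2[OF real_C1_on_continuous[OF C1_V] continuous_on_G(1)]) (use G_in in auto)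

lemma open_moving_pullback: "open moving_pullback"
proof -
  have "open (E \<inter> (\<lambda>\<zeta>. V (G \<zeta>)) -` (- {0}))"
    by (rule continuous_open_preimage[OF continuous_VG open_E]) auto
  then show ?thesis by (simp add: moving_pullback_def vimage_def Int_def)
qed

lemma moving_pullback_subset: "moving_pullback \<subseteq> E" by (auto simp: moving_pullback_def)

lemma G_moving_pullback: "G ` moving_pullback = moving"
  using G_image by (auto simp: moving_pullback_def moving_def)

text \<open>
  Here the truncation does what the no-slip condition alone cannot: \<open>V \<circ> G\<close> tends to \<open>0\<close> at the inner
  circle, but \<open>G'\<close> may blow up there. The truncated field vanishes identically near that circle.
\<close>

lemma circle_integral_conformal:
  assumes r: "r > r0"
  shows "circle_integral (\<lambda>\<zeta>. cnj (V (G \<zeta>)) * deriv G \<zeta>) r = integral (moving_pullback \<inter> annulus r0 r) pulled_vorticity"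
proof -
  define Y where "Y = (\<lambda>(n::nat) \<zeta>. cnj (truncate (real n) (V (G \<zeta>))) * deriv G \<zeta>)"
  define D where "D = (\<lambda>n \<zeta> h. trunc_deriv n (G \<zeta>) (deriv G \<zeta> * h) * deriv G \<zeta>
      + cnj (truncate (real n) (V (G \<zeta>))) * (deriv (deriv G) \<zeta> * h))"
  have C1: "real_C1_on E (Y n) (D n)" for n
    unfolding Y_def D_def
    by (intro real_C1_on_times_holomorphic real_C1_on_compose_holomorphic[OF C1_truncated] G_holo open_E holomorphic_deriv)
       (use G_in in auto)
  have dbar: "dbar (D n \<zeta>) = of_real ((norm (deriv G \<zeta>))\<^sup>2) * dbar (trunc_deriv n (G \<zeta>))" if "\<zeta> \<in> E" for n \<zeta>
    unfolding D_def dbar_times_holomorphic dbar_compose_holomorphic[OF linear_trunc_deriv[OF G_in[OF that]]]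
    by (simp only: complex_norm_square mult_ac)
  obtain R where R: "G ` annulus r0 r \<subseteq> ball 0 R" using G_annulus_bounded by blast
  define h where "h = (\<lambda>\<zeta>. 5 * ((norm (deriv G \<zeta>))\<^sup>2 * gradient_size (G \<zeta>)))"
  have hi: "h integrable_on annulus r0 r"
    unfolding h_def
    by (intro integrable_on_mult_right set_lebesgue_integral_eq_integral(1)[OF gradient_integrable(2)[OF open_annulus annulus_subset_E R]])
  have bound: "norm (dbar (D n \<zeta>)) \<le> h \<zeta>" if "\<zeta> \<in> annulus r0 r" for n \<zeta>
  proof -
    have "norm (dbar (D n \<zeta>)) = (norm (deriv G \<zeta>))\<^sup>2 * norm (dbar (trunc_deriv n (G \<zeta>)))"
      unfolding dbar[OF subsetD[OF annulus_subset_E that]] by (simp add: norm_mult norm_power)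
    also have "\<dots> \<le> (norm (deriv G \<zeta>))\<^sup>2 * (5 * gradient_size (G \<zeta>))"
      by (intro mult_left_mono norm_dbar_trunc_le) auto
    finally show ?thesis by (simp add: h_def)
  qed
  have int: "(\<lambda>\<zeta>. dbar (D n \<zeta>)) absolutely_integrable_on annulus r0 r" for n
  proof (rule measurable_bounded_by_integrable_imp_absolutely_integrable[OF _ _ hi bound])
    have "continuous_on E (\<lambda>\<zeta>. dbar (D n \<zeta>))"
      using C1[of n] unfolding real_C1_on_def dbar_def by (intro continuous_intros) auto
    then show "(\<lambda>\<zeta>. dbar (D n \<zeta>)) \<in> borel_measurable (lebesgue_on (annulus r0 r))"
      using open_annulus continuous_on_subset[OF _ annulus_subset_E]
      by (intro continuous_imp_measurable_on_sets_lebesgue) auto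
  qed (use open_annulus in auto)
  have G: "integral (annulus r0 r) (\<lambda>\<zeta>. dbar (D n \<zeta>)) = circle_integral (Y n) r" for n
  proof (rule Green_annulus_vanishing_inner[OF C1 _ r _ int])
    \<comment> \<open>\<open>n / (n + 1)\<^sup>2 \<le> 1\<close>, so this bound on \<open>|V|\<close> puts it below the truncation level, also for \<open>n = 0\<close>\<close>
    obtain d where d: "d > 0" "\<And>\<zeta>. r0 < norm \<zeta> \<Longrightarrow> norm \<zeta> < r0 + d \<Longrightarrow> norm (V (G \<zeta>)) < 1 / (real n + 1)"
      using V_G_vanishing[of "1 / (real n + 1)"] by auto
    have Y0: "Y n \<zeta> = 0" if "r0 < norm \<zeta>" "norm \<zeta> < r0 + d" for \<zeta>
    proof -
      have "(norm (V (G \<zeta>)))\<^sup>2 \<le> (1 / (real n + 1))\<^sup>2"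
        using d(2)[OF that] by (intro power_mono) auto
      then have "real n * (norm (V (G \<zeta>)))\<^sup>2 \<le> real n * (1 / (real n + 1))\<^sup>2" by (intro mult_left_mono) auto
      also have "\<dots> \<le> (real n + 1)\<^sup>2 * (1 / (real n + 1))\<^sup>2"
        by (intro mult_right_mono) (auto simp: power2_eq_square algebra_simps)
      also have "\<dots> = 1" by (simp add: power_divide)
      finally show ?thesis by (simp add: Y_def truncate_near_0)
    qed
    have "circle_integral (Y n) s = 0" if s: "r0 < s" "s < r0 + d" for s
      using norm_circle_integral_le[of s 0 "Y n"] Y0 s r0 by simp
    then show "(circle_integral (Y n) \<longlongrightarrow> 0) (at_right r0)"
      by (intro tendsto_eventually) (use d(1) in \<open>auto simp: eventually_at_right_field intro!: exI[of _ "r0 + d"]\<close>)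
  qed (use r0 in \<open>auto simp: outer_disc_def\<close>)
  have lim: "(\<lambda>n. integral (annulus r0 r) (\<lambda>\<zeta>. dbar (D n \<zeta>))) \<longlonglongrightarrow>
      integral (annulus r0 r) (\<lambda>\<zeta>. if \<zeta> \<in> moving_pullback then pulled_vorticity \<zeta> else 0)"
  proof (rule dominated_convergence(2)[OF _ hi bound])
    show "(\<lambda>\<zeta>. dbar (D n \<zeta>)) integrable_on annulus r0 r" for n
      by (rule set_lebesgue_integral_eq_integral(1)[OF int])
    fix \<zeta> assume "\<zeta> \<in> annulus r0 r"
    then have E: "\<zeta> \<in> E" using annulus_subset_E by blast
    have "(\<lambda>n. dbar (D n \<zeta>)) \<longlonglongrightarrow> of_real ((norm (deriv G \<zeta>))\<^sup>2) * (if V (G \<zeta>) = 0 then 0 else of_real (curl V (G \<zeta>)))"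
      unfolding dbar[OF E] by (intro tendsto_intros dbar_trunc_limit G_in E)
    also have "of_real ((norm (deriv G \<zeta>))\<^sup>2) * (if V (G \<zeta>) = 0 then 0 else of_real (curl V (G \<zeta>)))
        = (if \<zeta> \<in> moving_pullback then pulled_vorticity \<zeta> else 0)"
      using E by (auto simp: moving_pullback_def)
    finally show "(\<lambda>n. dbar (D n \<zeta>)) \<longlonglongrightarrow> (if \<zeta> \<in> moving_pullback then pulled_vorticity \<zeta> else 0)" .
  qed
  have restrict: "integral (annulus r0 r) (\<lambda>\<zeta>. if \<zeta> \<in> moving_pullback then pulled_vorticity \<zeta> else 0) = integral (moving_pullback \<inter> annulus r0 r) pulled_vorticity"
    by (simp only: integral_restrict_Int Int_commute)
  have boundary: "(\<lambda>n. circle_integral (Y n) r) \<longlonglongrightarrow> circle_integral (\<lambda>\<zeta>. cnj (V (G \<zeta>)) * deriv G \<zeta>) r"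
    unfolding Y_def
    by (rule circle_integral_truncate_tendsto)
       (use r r0 in \<open>auto intro!: continuous_on_subset[OF continuous_VG] continuous_on_subset[OF continuous_on_G(2)] simp: outer_disc_def\<close>)
  show ?thesis
    using LIMSEQ_unique[OF boundary lim[unfolded G]] unfolding restrict .
qed

lemma W_integrable: "pulled_vorticity absolutely_integrable_on moving_pullback"
proof -
  obtain h where h: "h integrable_on E" "\<And>\<zeta>. \<zeta> \<in> E \<Longrightarrow> (norm (deriv G \<zeta>))\<^sup>2 * \<bar>w \<zeta>\<bar> \<le> h \<zeta>"
    using vorticity_majorant by blast
  have cW: "continuous_on E pulled_vorticity"
    by (intro continuous_intros continuous_on_G continuous_on_compose2[OF continuous_curl continuous_on_G(1)]) (use G_in in auto)
  have "pulled_vorticity absolutely_integrable_on E"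
  proof (rule measurable_bounded_by_integrable_imp_absolutely_integrable[OF _ _ h(1)])
    show "pulled_vorticity \<in> borel_measurable (lebesgue_on E)"
      by (intro continuous_imp_measurable_on_sets_lebesgue cW) (use open_E in auto)
    show "norm (pulled_vorticity \<zeta>) \<le> h \<zeta>" if "\<zeta> \<in> E" for \<zeta>
      using h(2)[OF that] by (simp add: norm_mult norm_power vorticity_def)
  qed (use open_E in auto)
  then show ?thesis by (rule set_integrable_subset) (use moving_pullback_subset open_moving_pullback in auto)
qed

text \<open>
  The integral of \<open>curl V\<close> over \<open>moving\<close> is the limit of the integrals of \<open>cnj V dz\<close> over large
  circles. Being real it is the limit of their real parts, the circulations, while the
  imaginary parts are the fluxes through the circles.
\<close>

lemma total_vorticity_zero: "integral moving_pullback pulled_vorticity = 0"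
proof -
  have int: "(\<lambda>z. of_real (curl V z) :: complex) absolutely_integrable_on moving"
    using pullback(1)[OF open_moving_pullback moving_pullback_subset, of "\<lambda>z. of_real (curl V z)"] W_integrable
    unfolding G_moving_pullback by (rule iffD1)
  have eq: "integral moving_pullback pulled_vorticity = integral moving (\<lambda>z. of_real (curl V z))"
    using pullback(2)[OF open_moving_pullback moving_pullback_subset, of "\<lambda>z. of_real (curl V z)"] int
    unfolding G_moving_pullback by blast
  also have re: "\<dots> = of_real (integral moving (curl V))"
  proof -
    have "(curl V) integrable_on moving"
      using set_lebesgue_integral_eq_integral(1)[OF absolutely_integrable_linear[OF int bounded_linear_Re]]
      by (simp add: o_def)
    from integral_linear[OF this bounded_linear_of_real[where 'a = complex]] show ?thesis by (simp add: o_def)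
  qed
  finally have real: "integral moving_pullback pulled_vorticity = of_real (integral moving (curl V))" .
  obtain M where M: "\<And>z. norm z \<ge> M \<Longrightarrow> z \<in> interior \<Omega>"
    using near_infinity by metis
  have "(\<lambda>n::nat. integral (moving \<inter> ball 0 (real n)) (\<lambda>z. of_real (curl V z) :: complex))
      \<longlonglongrightarrow> integral moving (\<lambda>z. of_real (curl V z))"
  proof (rule integral_exhausting_tendsto[OF int])
    show "open (moving \<inter> ball 0 (real n))" for n using open_moving by blast
    show "\<forall>\<^sub>F n in sequentially. z \<in> moving \<inter> ball 0 (real n)" if "z \<in> moving" for z
      using that filterlim_real_sequentially[unfolded filterlim_at_top_dense, rule_format, of "norm z"] by simp
  qed auto
  then have "(\<lambda>n::nat. Re (integral (moving \<inter> ball 0 (real n)) (\<lambda>z. of_real (curl V z) :: complex)))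
      \<longlonglongrightarrow> integral moving (curl V)"
    unfolding re by (rule tendsto_Re[of _ "of_real _", simplified])
  moreover have "\<forall>\<^sub>F n::nat in sequentially.
      Re (integral (moving \<inter> ball 0 (real n)) (\<lambda>z. of_real (curl V z) :: complex)) = circulation V (real n)"
    using filterlim_real_sequentially[unfolded filterlim_at_top_dense, rule_format, of "max M 0"]
  proof eventually_elim
    fix n :: nat assume n: "max M 0 < real n"
    have sub: "sphere 0 (real n) \<subseteq> \<Omega>" using M n interior_subset[of \<Omega>] by fastforce
    have "Re (circle_integral (\<lambda>z. cnj (V z)) (real n)) = circulation V (real n)"
    proof -
      have "(\<lambda>\<theta>. cnj (V (of_real (real n) * cis \<theta>)) * (\<i> * of_real (real n) * cis \<theta>)) integrable_on {0..2*pi}"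
        by (rule circle_integrable) (auto intro!: continuous_intros continuous_on_subset[OF continuous_V sub])
      from integral_linear[OF this bounded_linear_Re]
      have "Re (circle_integral (\<lambda>z. cnj (V z)) (real n))
        = integral {0..2*pi} (\<lambda>\<theta>. Re (cnj (V (of_real (real n) * cis \<theta>)) * (\<i> * of_real (real n) * cis \<theta>)))"
        by (simp add: circle_integral_def o_def)
      also have "\<dots> = circulation V (real n)"
        unfolding circulation_def by (intro integral_cong) (simp add: inner_complex_def algebra_simps)
      finally show ?thesis .
    qed
    then show "Re (integral (moving \<inter> ball 0 (real n)) (\<lambda>z. of_real (curl V z) :: complex)) = circulation V (real n)"
      using circle_integral_physical[OF _ sub] n by simp
  qed
  ultimately have "(\<lambda>n::nat. circulation V (real n)) \<longlonglongrightarrow> integral moving (curl V)"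
    by (rule Lim_transform_eventually)
  moreover have "(\<lambda>n::nat. circulation V (real n)) \<longlonglongrightarrow> 0"
    by (rule filterlim_compose[OF circulation_limit filterlim_real_sequentially])
  ultimately have "integral moving (curl V) = 0" by (rule LIMSEQ_unique)
  then show ?thesis using real by simp
qed

text \<open>
  The circle integrals of \<open>cnj (V \<circ> G)\<close> and of \<open>cnj (V \<circ> G) G'\<close> differ by \<open>O(1/r)\<close>, as
  \<open>G' - 1 = O(r\<^sup>-\<^sup>2)\<close> on a circle of length \<open>2\<pi>r\<close>; the latter tend to the total vorticity.
\<close>

lemma zeroth_moment: "integral E (moment_integrand 0) = 0"
proof -
  define J where "J = (\<lambda>r. circle_integral (\<lambda>\<zeta>. cnj (V (G \<zeta>))) r)"
  define K where "K = (\<lambda>r. circle_integral (\<lambda>\<zeta>. cnj (V (G \<zeta>)) * deriv G \<zeta>) r)"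
  obtain C M where CM: "C \<ge> 0" "r0 < M" "\<And>\<zeta>. norm \<zeta> \<ge> M \<Longrightarrow> norm (deriv G \<zeta> - 1) \<le> C / (norm \<zeta>)\<^sup>2"
    using inverse_near_infinity by metis
  obtain B R where B: "B > 0" "\<And>\<zeta>. norm \<zeta> \<ge> R \<Longrightarrow> norm (V (G \<zeta>)) \<le> B"
    using V_G_bounded_far by metis
  have "((\<lambda>r. J r - K r) \<longlongrightarrow> 0) at_top"
  proof (rule Lim_null_comparison)
    show "((\<lambda>r. (2 * pi * B * C) / r) \<longlongrightarrow> 0) at_top"
      by (rule real_tendsto_divide_at_top[OF tendsto_const filterlim_ident])
    show "\<forall>\<^sub>F r in at_top. norm (J r - K r) \<le> (2 * pi * B * C) / r"
      using eventually_gt_at_top[of "max R M"]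
    proof eventually_elim
      fix r assume r: "max R M < r"
      have rp: "r > 0" using r CM r0 by simp
      have sub: "sphere 0 r \<subseteq> E" using r CM by (auto simp: outer_disc_def)
      have "J r - K r = circle_integral (\<lambda>\<zeta>. cnj (V (G \<zeta>)) - cnj (V (G \<zeta>)) * deriv G \<zeta>) r"
        unfolding J_def K_def using rp
        by (intro circle_integral_diff continuous_intros continuous_on_subset[OF continuous_VG sub]
              continuous_on_subset[OF continuous_on_G(2) sub]) auto
      also have "norm \<dots> \<le> 2 * pi * r * (B * (C / r\<^sup>2))"
      proof (rule norm_circle_integral_le)
        fix z :: complex assume z: "norm z = r"
        have "norm (cnj (V (G z)) - cnj (V (G z)) * deriv G z) = norm (V (G z)) * norm (deriv G z - 1)"
        proof -
          have "cnj (V (G z)) - cnj (V (G z)) * deriv G z = - (cnj (V (G z)) * (deriv G z - 1))"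
            by (simp add: algebra_simps)
          then show ?thesis by (simp only: norm_minus_cancel norm_mult complex_mod_cnj)
        qed
        also have "\<dots> \<le> B * (C / r\<^sup>2)"
          using B CM(3)[of z] z r by (intro mult_mono) auto
        finally show "norm (cnj (V (G z)) - cnj (V (G z)) * deriv G z) \<le> B * (C / r\<^sup>2)" .
      qed (use rp B CM in auto)
      also have "\<dots> = (2 * pi * B * C) / r" using rp by (simp add: power2_eq_square)
      finally show "norm (J r - K r) \<le> (2 * pi * B * C) / r" .
    qed
  qed
  moreover have "(K \<longlongrightarrow> 0) at_top"
  proof (rule tendsto_at_topI_sequentially)
    fix X :: "nat \<Rightarrow> real" assume X: "filterlim X at_top sequentially"
    have "(\<lambda>n. integral (moving_pullback \<inter> annulus r0 (X n)) pulled_vorticity) \<longlonglongrightarrow> integral moving_pullback pulled_vorticity"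
    proof (rule integral_exhausting_tendsto[OF W_integrable])
      show "open (moving_pullback \<inter> annulus r0 (X n))" for n using open_moving_pullback open_annulus by blast
      show "\<forall>\<^sub>F n in sequentially. z \<in> moving_pullback \<inter> annulus r0 (X n)" if "z \<in> moving_pullback" for z
        using X that unfolding filterlim_at_top_dense by (simp add: moving_pullback_def annulus_def outer_disc_def)
    qed auto
    moreover have "\<forall>\<^sub>F n in sequentially. integral (moving_pullback \<inter> annulus r0 (X n)) pulled_vorticity = K (X n)"
      using X[unfolded filterlim_at_top_dense, rule_format, of r0]
      by eventually_elim (simp only: K_def circle_integral_conformal)
    ultimately show "(\<lambda>n. K (X n)) \<longlonglongrightarrow> 0"
      unfolding total_vorticity_zero by (rule Lim_transform_eventually)
  qed
  ultimately have "((\<lambda>r. (J r - K r) + K r) \<longlongrightarrow> 0 + 0) at_top" by (rule tendsto_add)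
  then have "(J \<longlongrightarrow> 0) at_top" by simp
  moreover have "(J \<longlongrightarrow> integral E (moment_integrand 0)) at_top"
    using moment_as_limit[of 0] by (simp add: J_def)
  ultimately show ?thesis using tendsto_unique[OF trivial_limit_at_top_linorder] by metis
qed

lemma vorticity_in_moment_space: "w \<in> moment_space r0 \<Omega> \<Phi> vinf"
proof -
  have "integral E (moment_integrand k) = 4 * of_real pi * \<i> * of_nat k * vinf_r vinf (int k)" for k
  proof -
    consider "k = 0" | "k = 1" | "k \<ge> 2" by linarith
    then show ?thesis
    proof cases
      case 1 then show ?thesis using zeroth_moment by simp
    next
      case 2 then show ?thesis using first_moment by (simp add: vinf_r_def complex_eq_iff)
    next
      case 3 then show ?thesis using higher_moments[OF 3] by (simp add: vinf_r_def)
    qed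
  qed
  then show ?thesis
    unfolding moment_space_def
    using vorticity_integrable moment_integrable set_lebesgue_integral_eq_integral(2)[OF moment_integrable]
    by simp
qed

end

theorem theorem3p2:
  fixes r0 :: real
    and B \<Omega> :: "complex set"
    and \<Phi> :: "complex \<Rightarrow> complex"
    and vinf :: complex
    and v0 :: "complex \<Rightarrow> complex"
    and v :: "real \<Rightarrow> complex \<Rightarrow> complex"
  assumes "r0 > 0"
    and "open B" "B \<noteq> {}" "bounded B" "simply_connected B" "piecewise_smooth_boundary B"
    and "\<Omega> = - B"
    and "exterior_riemann_map r0 \<Omega> \<Phi>"
    and "velocity_field_on \<Omega> v0"
    and "divergence_free_on \<Omega> v0"
    and "no_slip \<Omega> v0"
    and "(v0 \<longlongrightarrow> vinf) at_infinity"
    and "(circulation v0 \<longlongrightarrow> 0) at_top"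
    and "vorticity \<Omega> \<Phi> v0 absolutely_integrable_on outer_disc r0"
    and "\<forall>z\<in>\<Omega>. v 0 z = v0 z"
    and "\<And>t. t \<ge> 0 \<Longrightarrow> velocity_field_on \<Omega> (v t)"
    and "\<And>t. t \<ge> 0 \<Longrightarrow> divergence_free_on \<Omega> (v t)"
    and "\<And>t. t \<ge> 0 \<Longrightarrow> vorticity \<Omega> \<Phi> (v t) absolutely_integrable_on outer_disc r0"
    and "\<And>t. t \<ge> 0 \<Longrightarrow> (v t \<longlongrightarrow> vinf) at_infinity"
    and "\<And>t. t \<ge> 0 \<Longrightarrow> (circulation (v t) \<longlongrightarrow> 0) at_top"
  shows "vorticity \<Omega> \<Phi> v0 \<in> moment_space r0 \<Omega> \<Phi> vinf \<and>
    ((\<forall>t>0. no_slip \<Omega> (v t)) \<longrightarrow>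
     (\<forall>t>0. vorticity \<Omega> \<Phi> (v t) \<in> moment_space r0 \<Omega> \<Phi> vinf))"
proof (intro conjI impI allI)
  have ext: "exterior_map r0 \<Omega> \<Phi>"
    by unfold_locales (use assms(1,2,4,7,8) in auto)
  show "vorticity \<Omega> \<Phi> v0 \<in> moment_space r0 \<Omega> \<Phi> vinf"
    by (intro no_slip_field.vorticity_in_moment_space no_slip_field.intro no_slip_field_axioms.intro ext)
       (use assms in auto)
  show "vorticity \<Omega> \<Phi> (v t) \<in> moment_space r0 \<Omega> \<Phi> vinf" if "\<forall>t>0. no_slip \<Omega> (v t)" "t > 0" for t
    by (intro no_slip_field.vorticity_in_moment_space no_slip_field.intro no_slip_field_axioms.intro ext)
       (use assms that in auto)
qed

end
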